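(* For $n=4,5,\dots$, \[ N_{\rm bi}(n, 1) = n^{n-1} \sum_{2 \le k \le n/2}\dfrac{n !}{(n-2k)!\, n^{2k}}, \] and \[ N_{\rm bi}(n,1) \sim \sqrt{\dfrac{\pi}{8}}\, n^{n-1/2} \quad (n \to \infty). \]
   Context: For integers $r,s\ge 0$ and $k$, $N_{\rm bi}(r,s,k)$ is the number of connected bipartite simple graphs with labeled bipartition $V_1\sqcup V_2$, $|V_1|=r$, $|V_2|=s$, having exactly $r+s+k-1$ edges; equivalently, the number of connected spanning subgraphs of the complete bipartite graph $K_{r,s}$ with $r+s+k-1$ edges (so the Betti number is $k$). Conventions: if $rs=0$, then $N_{\rm bi}(r,s,k)=1$ if $k=0$ and $(r,s)\in\{(1,0),(0,1)\}$, and $0$ otherwise. Define \[ N_{\rm bi}(n,k) := \sum_{r+s=n}\binom{n}{r}N_{\rm bi}(r,s,k), \] which is the coefficient of $x^n/n!$ in $F_k(x,x)$, where $F_k(x,y)=\sum_{r,s\ge0}\frac{N_{\rm bi}(r,s,k)}{r!s!}x^ry^s$. Here $a_n\sim b_n$ means $a_n/b_n\to1$. *)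

theory Defs
  imports
    Complex_Main
    "HOL-Library.Landau_Symbols"
    "Graph_Theory.Pair_Digraph"
    "Graph_Theory.Digraph_Component"
begin

text \<open>
  Simple graphs are given by a vertex set and a set of edges, the edges being two-element sets of
  vertices. The library works with digraphs; an undirected graph is the digraph that has both arcs
  of every edge.
\<close>

definition graph_of :: "'a set \<Rightarrow> 'a set set \<Rightarrow> 'a pair_pre_digraph" where
  "graph_of V E = \<lparr>pverts = V, parcs = {(u, v). {u, v} \<in> E}\<rparr>"

text \<open>
  The labelled sides of \<open>K\<^bsub>r,s\<^esub>\<close> are \<open>{0..<r}\<close> and \<open>{0..<s}\<close>, made disjoint by \<open>Inl\<close> and \<open>Inr\<close>.
\<close>

definition bip_verts :: "nat \<Rightarrow> nat \<Rightarrow> (nat + nat) set" where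
  "bip_verts r s = {..<r} <+> {..<s}"

definition complete_bip_edges :: "nat \<Rightarrow> nat \<Rightarrow> (nat + nat) set set" where
  "complete_bip_edges r s = {{Inl i, Inr j} | i j. i < r \<and> j < s}"

text \<open>
  The constant \<open>Digraph_Component.connected\<close> is graph connectedness; the unqualified name could
  also denote the topological notion. The number \<open>k\<close> is an integer and the edge count is compared
  in \<open>int\<close>, so that no subtraction is truncated.
\<close>

definition N_bi :: "nat \<Rightarrow> nat \<Rightarrow> int \<Rightarrow> nat" where
  "N_bi r s k =
    (if r * s = 0 then (if k = 0 \<and> (r, s) \<in> {(1, 0), (0, 1)} then 1 else 0)
     else card {E. E \<subseteq> complete_bip_edges r s
       \<and> Digraph_Component.connected (with_proj (graph_of (bip_verts r s) E))
       \<and> int (card E) = int r + int s + k - 1})"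

definition N_bi_total :: "nat \<Rightarrow> int \<Rightarrow> nat" where
  "N_bi_total n k = (\<Sum>(r, s) | r + s = n. (n choose r) * N_bi r s k)"

end

theory Submission
  imports
    Defs
    "HOL-Combinatorics.Multiset_Permutations"
    "HOL-Probability.Distributions"
    "HOL-Real_Asymp.Real_Asymp"
begin

text \<open>
  Distributing the \<open>n\<close> labels over the two sides, \<open>N_bi_total n 1\<close> counts the connected graphs with
  \<open>n\<close> vertices and \<open>n\<close> edges together with an ordered proper 2-colouring; let \<open>u(n)\<close> be this number.
  In such a graph the leaves of any set \<open>L\<close> are attached to vertices outside \<open>L\<close>, so
  \<open>u(n - l) (n - l)\<^sup>l\<close> of the graphs have all elements of a given \<open>l\<close>-set as leaves.
  Inclusion-exclusion expresses the number of leafless graphs, that is of properly 2-coloured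
  Hamiltonian cycles, as \<open>\<Sum>l. (-1)\<^sup>l (n choose l) (n - l)\<^sup>l u(n - l)\<close>. It is \<open>(n - 1)!\<close> for even
  \<open>n \<ge> 4\<close> and \<open>0\<close> otherwise. The relation determines \<open>u\<close>, and the claimed sum satisfies it because
  an \<open>N\<close>-th finite difference of a polynomial of degree below \<open>N\<close> vanishes.

  For the asymptotics, the \<open>k\<close>-th summand is \<open>\<Prod>i<2k. (1 - i/n)\<close>, which tends to \<open>exp (- x\<^sup>2)\<close> for
  \<open>k = \<lfloor>x sqrt (n/2)\<rfloor>\<close>. By dominated convergence the sum is asymptotic to
  \<open>sqrt (n/2)\<close> times the Gaussian integral over the half-line.
\<close>

section \<open>Finite differences and the inverse leaf transform\<close>

text \<open>Induction on \<open>N\<close>. Pascal's rule turns the difference of order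
  \<open>Suc N\<close> into \<open>D d x - D d (x - 1)\<close>. Expanding
  \<open>(x - real l) ^ d\<close> in powers of \<open>x - 1 - real l\<close> cancels
  \<open>D d (x - 1)\<close>; what remains are multiples of \<open>D j (x - 1)\<close> with
  \<open>j < d\<close>, hence \<open>j < N\<close>, and these vanish by induction.\<close>

lemma alternating_binomial_power_zero:
  fixes x :: real
  assumes "d < N"
  shows "(\<Sum>l\<le>N. (-1) ^ l * real (N choose l) * (x - real l) ^ d) = 0"
  using assms
proof (induction N arbitrary: d x)
  case (Suc N)
  define D where "D e y = (\<Sum>l\<le>N. (-1) ^ l * real (N choose l) * (y - real l) ^ e)" for e and y :: real
  have "(\<Sum>l\<le>Suc N. (-1) ^ l * real (Suc N choose l) * (x - real l) ^ d) =
     x ^ d + (\<Sum>l\<le>N. (-1) ^ Suc l * real (Suc N choose Suc l) * (x - real (Suc l)) ^ d)"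
    by (subst sum.atMost_Suc_shift) simp
  also have "(\<Sum>l\<le>N. (-1) ^ Suc l * real (Suc N choose Suc l) * (x - real (Suc l)) ^ d) =
     (\<Sum>l\<le>N. (-1) ^ Suc l * real (N choose Suc l) * (x - real (Suc l)) ^ d) - D d (x - 1)"
    unfolding D_def sum_subtractf[symmetric] by (intro sum.cong) (simp_all add: algebra_simps)
  also have "(\<Sum>l\<le>N. (-1) ^ Suc l * real (N choose Suc l) * (x - real (Suc l)) ^ d) =
     (\<Sum>l\<le>Suc N. (-1) ^ l * real (N choose l) * (x - real l) ^ d) - x ^ d"
    using sum.atMost_Suc_shift[of "\<lambda>l. (-1) ^ l * real (N choose l) * (x - real l) ^ d" N]
    by (simp del: sum.atMost_Suc)
  also have "(\<Sum>l\<le>Suc N. (-1) ^ l * real (N choose l) * (x - real l) ^ d) = D d x"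
    by (simp add: D_def)
  finally have "(\<Sum>l\<le>Suc N. (-1) ^ l * real (Suc N choose l) * (x - real l) ^ d) = D d x - D d (x - 1)"
    by simp
  also have "D d x = D d (x - 1) + (\<Sum>j<d. real (d choose j) * D j (x - 1))"
  proof -
    have "(x - real l) ^ d = (\<Sum>j\<le>d. real (d choose j) * (x - 1 - real l) ^ j)" for l
      using binomial_ring[of "x - 1 - real l" 1 d] by simp
    then have "D d x = (\<Sum>l\<le>N. \<Sum>j\<le>d. real (d choose j) * ((-1) ^ l * real (N choose l) * (x - 1 - real l) ^ j))"
      by (simp add: D_def sum_distrib_left mult_ac)
    also have "\<dots> = (\<Sum>j\<le>d. real (d choose j) * D j (x - 1))"
      by (subst sum.swap) (simp add: D_def sum_distrib_left)
    also have "\<dots> = D d (x - 1) + (\<Sum>j<d. real (d choose j) * D j (x - 1))"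
      by (simp add: lessThan_Suc_atMost[symmetric])
    finally show ?thesis .
  qed
  also have "(\<Sum>j<d. real (d choose j) * D j (x - 1)) = 0"
    using Suc.IH Suc.prems by (intro sum.neutral) (simp add: D_def)
  finally show ?case by simp
qed simp

text \<open>The exponent \<open>n - 2 * k - 1\<close> is written as a quotient since it is \<open>-1\<close> for \<open>n = 2 * k\<close>.\<close>

definition cycle_sum :: "nat \<Rightarrow> real" where
  "cycle_sum n = (\<Sum>k | 2 \<le> k \<and> 2 * k \<le> n. fact n / fact (n - 2 * k) * (real n ^ (n - 2 * k) / real n))"

text \<open>For even n there are (n - 1)!/2 Hamiltonian cycles on n labels, each with two proper
  colourings. The value n = 2 is left out because a simple graph has no cycle of length 2.\<close>

definition coloured_cycles :: "nat \<Rightarrow> real" where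
  "coloured_cycles n = (if even n \<and> n \<ge> 4 then fact (n - 1) else 0)"

text \<open>This handles one summand of \<open>cycle_sum\<close>, with \<open>m\<close> standing for
  \<open>2 * k\<close>. Put N = n - m. The binomial coefficient and the factorials regroup to n!/N!
  times (N choose l), and the powers combine to (n - l)^(N - 1), a polynomial in l of degree below
  N, so its N-th difference is zero. If \<open>m = n\<close>, only l = 0 survives and contributes
  n!/n.\<close>

lemma leaf_transform_term:
  assumes "0 < m" "m \<le> n"
  shows "(\<Sum>l\<le>n. (-1) ^ l * real (n choose l) * real (n - l) ^ l *
      (if m \<le> n - l then fact (n - l) / fact (n - l - m) * (real (n - l) ^ (n - l - m) / real (n - l)) else 0))
    = (if m = n then fact (n - 1) else 0)"
proof (cases "m = n")
  case True
  have "(\<Sum>l\<le>n. (-1) ^ l * real (n choose l) * real (n - l) ^ l *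
      (if m \<le> n - l then fact (n - l) / fact (n - l - m) * (real (n - l) ^ (n - l - m) / real (n - l)) else 0))
    = (\<Sum>l\<le>n. if l = 0 then fact n / real n else 0)"
    using True assms by (intro sum.cong) auto
  also have "\<dots> = fact (n - 1)" using assms by (cases n) (auto simp: field_simps)
  finally show ?thesis using True by simp
next
  case False
  define N where "N = n - m"
  have N: "N > 0" "N \<le> n" using False assms by (auto simp: N_def)
  have "(\<Sum>l\<le>n. (-1) ^ l * real (n choose l) * real (n - l) ^ l *
      (if m \<le> n - l then fact (n - l) / fact (n - l - m) * (real (n - l) ^ (n - l - m) / real (n - l)) else 0))
    = (\<Sum>l\<le>N. (-1) ^ l * real (n choose l) * real (n - l) ^ l *
      (fact (n - l) / fact (n - l - m) * (real (n - l) ^ (n - l - m) / real (n - l))))"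
    by (rule sum.mono_neutral_cong_right) (use N assms in \<open>auto simp: N_def\<close>)
  also have "\<dots> = (\<Sum>l\<le>N. fact n / fact N * ((-1) ^ l * real (N choose l) * (real n - real l) ^ (N - 1)))"
  proof (rule sum.cong)
    fix l assume l: "l \<in> {..N}"
    have a: "real (n choose l) * (fact (n - l) / fact (n - l - m)) = fact n / fact N * real (N choose l)"
      using l N by (simp add: binomial_fact N_def add.commute)
    have b: "real (n - l) ^ l * (real (n - l) ^ (n - l - m) / real (n - l)) = (real n - real l) ^ (N - 1)"
    proof -
      \<comment> \<open>Since \<open>m > 0\<close>, the base \<open>n - l\<close> stays positive, so
        the division is genuine even at \<open>l = N\<close>, where the exponent
        \<open>n - l - m\<close> is 0.\<close>
      have "l < n" using l N assms by (auto simp: N_def)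
      have "l + (n - l - m) = Suc (N - 1)" using l N by (auto simp: N_def)
      then have "real (n - l) ^ l * real (n - l) ^ (n - l - m) = real (n - l) * real (n - l) ^ (N - 1)"
        by (metis power_add power_Suc)
      then show ?thesis using \<open>l < n\<close> by (simp add: of_nat_diff field_simps)
    qed
    show "(-1) ^ l * real (n choose l) * real (n - l) ^ l *
        (fact (n - l) / fact (n - l - m) * (real (n - l) ^ (n - l - m) / real (n - l)))
      = fact n / fact N * ((-1) ^ l * real (N choose l) * (real n - real l) ^ (N - 1))"
      using arg_cong2[OF a b, of "\<lambda>u v. (-1) ^ l * (u * v)"] by (simp add: mult_ac)
  qed simp
  also have "\<dots> = 0"
    using alternating_binomial_power_zero[of "N - 1" N "real n"] N
    unfolding sum_distrib_left[symmetric] by simp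
  finally show ?thesis using False by simp
qed

lemma leaf_transform_cycle_sum:
  assumes "n > 0"
  shows "(\<Sum>l\<le>n. (-1) ^ l * real (n choose l) * real (n - l) ^ l * cycle_sum (n - l)) = coloured_cycles n"
proof -
  define K where "K = {k. 2 \<le> k \<and> 2 * k \<le> n}"
  have fin: "finite K" by (rule finite_subset[of _ "{..n}"]) (auto simp: K_def)
  \<comment> \<open>Padding with zeros to the range \<open>K\<close>, which does not depend on
    \<open>l\<close>, allows the two summations to be exchanged.\<close>
  have "cycle_sum (n - l) = (\<Sum>k\<in>K. if 2 * k \<le> n - l then fact (n - l) / fact (n - l - 2 * k) *
      (real (n - l) ^ (n - l - 2 * k) / real (n - l)) else 0)" for l
    unfolding cycle_sum_def using fin by (intro sum.mono_neutral_cong_left) (auto simp: K_def)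
  then have "(\<Sum>l\<le>n. (-1) ^ l * real (n choose l) * real (n - l) ^ l * cycle_sum (n - l)) =
    (\<Sum>l\<le>n. \<Sum>k\<in>K. (-1) ^ l * real (n choose l) * real (n - l) ^ l *
      (if 2 * k \<le> n - l then fact (n - l) / fact (n - l - 2 * k) *
      (real (n - l) ^ (n - l - 2 * k) / real (n - l)) else 0))"
    by (simp only: sum_distrib_left)
  also have "\<dots> = (\<Sum>k\<in>K. if 2 * k = n then fact (n - 1) else 0)"
    by (subst sum.swap) (intro sum.cong refl leaf_transform_term, use assms in \<open>auto simp: K_def\<close>)
  also have "\<dots> = coloured_cycles n"
  proof (cases "even n \<and> n \<ge> 4")
    case True
    then obtain j where j: "n = 2 * j" by auto
    then have "(\<Sum>k\<in>K. if 2 * k = n then fact (n - 1) else (0::real)) = (\<Sum>k\<in>K. if k = j then fact (n - 1) else 0)"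
      by (intro sum.cong) auto
    also have "\<dots> = fact (n - 1)" using fin True j by (simp add: K_def)
    finally show ?thesis using True by (simp add: coloured_cycles_def)
  next
    case False
    then have "(\<Sum>k\<in>K. if 2 * k = n then fact (n - 1) else (0::real)) = 0"
      by (intro sum.neutral) (auto simp: K_def)
    then show ?thesis using False by (auto simp: coloured_cycles_def)
  qed
  finally show ?thesis .
qed

section \<open>Connected graphs with a colour class\<close>

text \<open>A nonempty vertex set that no edge leaves must be everything. This form needs no paths,
  which makes adding and deleting a leaf easy; \<open>connected_graph_of_iff\<close> relates it to
  reachability. The empty vertex set counts as connected.\<close>

definition conn :: "'a set \<Rightarrow> 'a set set \<Rightarrow> bool" where
  "conn V E \<longleftrightarrow> (\<forall>S\<subseteq>V. S \<noteq> {} \<longrightarrow> (\<forall>e\<in>E. e \<inter> S \<noteq> {} \<longrightarrow> e \<subseteq> S) \<longrightarrow> S = V)"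

definition cross :: "'a set \<Rightarrow> 'a set \<Rightarrow> 'a set set" where
  "cross A B = {{a, b} | a b. a \<in> A \<and> b \<in> B}"

text \<open>The pairs of first colour class and edge set. Pitfall: \<open>unicyclic {} = {({}, {})}\<close>.\<close>

definition unicyclic :: "'a set \<Rightarrow> ('a set \<times> 'a set set) set" where
  "unicyclic V = {(A, E). A \<subseteq> V \<and> E \<subseteq> cross A (V - A) \<and> conn V E \<and> card E = card V}"

definition leaves :: "'a set set \<Rightarrow> 'a set" where
  "leaves E = {v. card {e \<in> E. v \<in> e} = 1}"

lemma connD:
  assumes "conn V E" "S \<subseteq> V" "S \<noteq> {}" "\<And>e. e \<in> E \<Longrightarrow> e \<inter> S \<noteq> {} \<Longrightarrow> e \<subseteq> S"
  shows "S = V"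
  using assms unfolding conn_def by blast

lemma cross_subset: "e \<in> cross A B \<Longrightarrow> e \<subseteq> A \<union> B"
  by (auto simp: cross_def)

lemma finite_cross: "finite A \<Longrightarrow> finite B \<Longrightarrow> finite (cross A B)"
proof -
  assume "finite A" "finite B"
  moreover have "cross A B = (\<lambda>(a, b). {a, b}) ` (A \<times> B)" by (auto simp: cross_def)
  ultimately show ?thesis by simp
qed

lemma finite_edges: "finite V \<Longrightarrow> A \<subseteq> V \<Longrightarrow> E \<subseteq> cross A (V - A) \<Longrightarrow> finite E"
  by (meson finite_Diff finite_cross finite_subset)

lemma finite_unicyclic: "finite V \<Longrightarrow> finite (unicyclic V)"
proof -
  assume fin: "finite V"
  have "unicyclic V \<subseteq> Pow V \<times> Pow (\<Union>A\<in>Pow V. cross A (V - A))"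
    by (auto simp: unicyclic_def)
  moreover have "finite (Pow V \<times> Pow (\<Union>A\<in>Pow V. cross A (V - A)))"
    using fin by (intro finite_SigmaI finite_Pow_iff[THEN iffD2] finite_UN_I finite_cross)
      (auto dest: finite_subset)
  ultimately show ?thesis by (rule finite_subset)
qed

lemma leaves_subset:
  assumes "(A, E) \<in> unicyclic V" shows "leaves E \<subseteq> V"
proof
  fix v assume "v \<in> leaves E"
  then have "card {e \<in> E. v \<in> e} \<noteq> 0" by (simp add: leaves_def)
  then have "{e \<in> E. v \<in> e} \<noteq> {}" by (metis card.empty)
  then obtain e where "e \<in> E" "v \<in> e" by blast
  then show "v \<in> V" using assms cross_subset[of e A "V - A"] by (auto simp: unicyclic_def)
qed

section \<open>Coloured cycles\<close>

definition cyc_edge :: "'a list \<Rightarrow> nat \<Rightarrow> 'a set" where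
  "cyc_edge xs i = {xs ! i, xs ! (if Suc i = length xs then 0 else Suc i)}"

definition cyc :: "'a list \<Rightarrow> 'a set set" where
  "cyc xs = cyc_edge xs ` {..<length xs}"

definition evens :: "'a list \<Rightarrow> 'a set" where
  "evens xs = {xs ! i | i. i < length xs \<and> even i}"

text \<open>Let s be the cyclic successor on indices. Equal edges with i different from j would
  force s i = j and s j = i, and s has no such 2-cycle once the length is at least 3.\<close>

lemma cyc_edge_inj:
  assumes "distinct xs" "length xs \<ge> 3" "i < length xs" "j < length xs" "cyc_edge xs i = cyc_edge xs j"
  shows "i = j"
proof -
  have eq: "xs ! k = xs ! l \<longleftrightarrow> k = l" if "k < length xs" "l < length xs" for k l
    using that assms(1) by (simp add: nth_eq_iff_index_eq)
  define s where "s k = (if Suc k = length xs then 0 else Suc k)" for k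
  have "s i < length xs" "s j < length xs" "s i = j \<Longrightarrow> s j \<noteq> i" "s i = s j \<Longrightarrow> i = j"
    using assms(2-4) by (auto simp: s_def split: if_splits)
  then show ?thesis using assms(3-5) eq unfolding cyc_edge_def s_def[symmetric] doubleton_eq_iff
    by metis
qed

lemma card_cyc:
  assumes "distinct xs" "length xs \<ge> 3"
  shows "card (cyc xs) = length xs"
  unfolding cyc_def using cyc_edge_inj[OF assms] by (subst card_image) (auto simp: inj_on_def)

lemma cyc_edges_at:
  assumes "distinct xs" "length xs \<ge> 3" "i < length xs"
  shows "{e \<in> cyc xs. xs ! i \<in> e} = {cyc_edge xs i, cyc_edge xs (if i = 0 then length xs - 1 else i - 1)}"
proof (intro equalityI subsetI)
  fix e assume "e \<in> {e \<in> cyc xs. xs ! i \<in> e}"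
  then obtain j where j: "j < length xs" "e = cyc_edge xs j" "xs ! i \<in> cyc_edge xs j"
    by (auto simp: cyc_def)
  moreover have "(if Suc j = length xs then 0 else Suc j) < length xs" using j(1) by auto
  ultimately have "i = j \<or> i = (if Suc j = length xs then 0 else Suc j)"
    using assms(1,3) nth_eq_iff_index_eq unfolding cyc_edge_def by blast
  then have "j = i \<or> j = (if i = 0 then length xs - 1 else i - 1)" by (auto split: if_splits)
  then show "e \<in> {cyc_edge xs i, cyc_edge xs (if i = 0 then length xs - 1 else i - 1)}"
    using j(2) by blast
next
  fix e assume e: "e \<in> {cyc_edge xs i, cyc_edge xs (if i = 0 then length xs - 1 else i - 1)}"
  define j where "j = (if i = 0 then length xs - 1 else i - 1)"
  have "j < length xs" "i = (if Suc j = length xs then 0 else Suc j)" using assms(2,3) by (auto simp: j_def)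
  then have "cyc_edge xs j \<in> cyc xs" "xs ! i \<in> cyc_edge xs j" by (auto simp: cyc_def cyc_edge_def)
  moreover have "cyc_edge xs i \<in> cyc xs" "xs ! i \<in> cyc_edge xs i"
    using assms(3) by (auto simp: cyc_def cyc_edge_def)
  ultimately show "e \<in> {e \<in> cyc xs. xs ! i \<in> e}" using e unfolding j_def by blast
qed

lemma card_cyc_edges_at:
  assumes "distinct xs" "length xs \<ge> 3" "i < length xs"
  shows "card {e \<in> cyc xs. xs ! i \<in> e} = 2"
proof -
  define j where "j = (if i = 0 then length xs - 1 else i - 1)"
  have "j < length xs" "i \<noteq> j" using assms(2,3) by (auto simp: j_def)
  then have "cyc_edge xs i \<noteq> cyc_edge xs j" using cyc_edge_inj[OF assms] by blast
  then show ?thesis unfolding cyc_edges_at[OF assms] j_def[symmetric] by simp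
qed

lemma Union_cyc: "\<Union> (cyc xs) \<subseteq> set xs"
proof -
  have "cyc_edge xs i \<subseteq> set xs" if "i < length xs" for i
  proof -
    have "(if Suc i = length xs then 0 else Suc i) < length xs" using that by auto
    then show ?thesis using that unfolding cyc_edge_def by (metis empty_subsetI insert_subset nth_mem)
  qed
  then show ?thesis by (auto simp: cyc_def)
qed

lemma leaves_cyc:
  assumes "distinct xs" "length xs \<ge> 3"
  shows "leaves (cyc xs) = {}"
proof -
  have "card {e \<in> cyc xs. v \<in> e} \<noteq> 1" for v
  proof (cases "v \<in> set xs")
    case True
    then show ?thesis using card_cyc_edges_at[OF assms] by (auto simp: in_set_conv_nth)
  next
    case False
    then have "{e \<in> cyc xs. v \<in> e} = {}" using Union_cyc[of xs] by blast
    then show ?thesis by (metis card.empty zero_neq_one)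
  qed
  then show ?thesis by (auto simp: leaves_def)
qed

text \<open>A closed set containing one entry contains all later ones up to the end of the list,
  hence by the wrap-around edge also entry 0, and from there every entry.\<close>

lemma conn_cyc: "conn (set xs) (cyc xs)"
  unfolding conn_def
proof (intro allI impI)
  fix S assume S: "S \<subseteq> set xs" "S \<noteq> {}" "\<forall>e\<in>cyc xs. e \<inter> S \<noteq> {} \<longrightarrow> e \<subseteq> S"
  have nxt: "xs ! (if Suc i = length xs then 0 else Suc i) \<in> S" if "i < length xs" "xs ! i \<in> S" for i
  proof -
    have "cyc_edge xs i \<in> cyc xs" "cyc_edge xs i \<inter> S \<noteq> {}"
      using that by (simp_all add: cyc_def cyc_edge_def)
    then have "cyc_edge xs i \<subseteq> S" using S(3) by blast
    then show ?thesis by (simp add: cyc_edge_def)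
  qed
  have up: "xs ! j \<in> S" if "i \<le> j" "j < length xs" "xs ! i \<in> S" for i j
    using that(1,2)
  proof (induction rule: dec_induct)
    case (step k)
    then show ?case using nxt[of k] by simp
  qed (use that in auto)
  obtain i where i: "i < length xs" "xs ! i \<in> S" using S(1,2) by (metis all_not_in_conv in_set_conv_nth subsetD)
  have "xs ! (length xs - 1) \<in> S" using up[of i "length xs - 1"] i by auto
  moreover have "length xs - 1 < length xs" "Suc (length xs - 1) = length xs" using i(1) by auto
  ultimately have "xs ! 0 \<in> S" using nxt[of "length xs - 1"] by presburger
  then have "xs ! j \<in> S" if "j < length xs" for j using up[of 0 j] that by simp
  then show "S = set xs" using S(1) by (auto simp: in_set_conv_nth)
qed

lemma nth_mem_evens:
  assumes "distinct xs" "i < length xs"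
  shows "xs ! i \<in> evens xs \<longleftrightarrow> even i"
  using assms by (auto simp: evens_def nth_eq_iff_index_eq)

lemma cyc_subset_cross:
  assumes "distinct xs" "even (length xs)"
  shows "cyc xs \<subseteq> cross (evens xs) (set xs - evens xs)"
proof
  fix e assume "e \<in> cyc xs"
  then obtain i where i: "i < length xs" "e = cyc_edge xs i" by (auto simp: cyc_def)
  define j where "j = (if Suc i = length xs then 0 else Suc i)"
  \<comment> \<open>Even length makes the last index odd, so the closing edge back to index 0
    changes parity like all the others.\<close>
  have "odd i" if "Suc i = length xs" using assms(2) that by (metis even_Suc)
  then have j: "j < length xs" "odd i \<longleftrightarrow> even j" using i by (auto simp: j_def)
  have e: "e = {xs ! i, xs ! j}" "e = {xs ! j, xs ! i}" using i by (auto simp: cyc_edge_def j_def)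
  show "e \<in> cross (evens xs) (set xs - evens xs)"
  proof (cases "even i")
    case True
    then have "xs ! i \<in> evens xs" "xs ! j \<in> set xs - evens xs"
      using i(1) j by (simp_all add: nth_mem_evens[OF assms(1)])
    then show ?thesis using e(1) unfolding cross_def by blast
  next
    case False
    then have "xs ! j \<in> evens xs" "xs ! i \<in> set xs - evens xs"
      using i(1) j by (simp_all add: nth_mem_evens[OF assms(1)])
    then show ?thesis using e(2) unfolding cross_def by blast
  qed
qed

text \<open>The list is reconstructed step by step: exactly two edges meet the current vertex, one
  of them leads back to the previous entry, and the other one therefore determines the next
  entry.\<close>

lemma cyc_determines_list:
  assumes "distinct xs" "distinct ys" "length xs = length ys" "length xs \<ge> 3"
    and "cyc xs = cyc ys" "xs ! 0 = ys ! 0" "xs ! 1 = ys ! 1"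
  shows "xs = ys"
proof -
  have "Suc i < length xs \<Longrightarrow> xs ! i = ys ! i \<and> xs ! Suc i = ys ! Suc i" for i
  proof (induction i)
    case (Suc i)
    have "cyc_edge ys (Suc i) \<in> {e \<in> cyc ys. ys ! Suc i \<in> e}"
      using Suc.prems assms by (auto simp: cyc_def cyc_edge_def)
    also have "{e \<in> cyc ys. ys ! Suc i \<in> e} = {e \<in> cyc xs. xs ! Suc i \<in> e}"
      using Suc assms by simp
    also have "\<dots> = {cyc_edge xs (Suc i), cyc_edge xs i}"
      using cyc_edges_at[of xs "Suc i"] Suc.prems assms by simp
    finally have "{ys ! Suc i, ys ! Suc (Suc i)} \<in> {{xs ! Suc i, xs ! Suc (Suc i)}, {xs ! i, xs ! Suc i}}"
      using Suc.prems assms(3) by (auto simp: cyc_edge_def)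
    moreover have "ys ! Suc (Suc i) \<noteq> ys ! i" "ys ! Suc (Suc i) \<noteq> ys ! Suc i"
      using Suc.prems assms(2,3) by (auto simp: nth_eq_iff_index_eq)
    ultimately show ?case using Suc by (auto simp: doubleton_eq_iff)
  qed (use assms in auto)
  note * = this
  have "xs ! i = ys ! i" if "i < length xs" for i
  proof (cases i)
    case (Suc k)
    then show ?thesis using *[of k] that by simp
  qed (use assms in simp)
  then show ?thesis using assms(3) by (intro nth_equalityI)
qed

text \<open>The degrees sum to twice the number of edges, which is \<open>2 * card V\<close>. Every
  degree is at least 2: degree 1 is a leaf, and an isolated vertex would by connectedness be the
  whole graph, which then has no edge instead of one. So equality holds at every vertex.\<close>

lemma leafless_card_edges_at:
  assumes "finite V" "(A, E) \<in> unicyclic V" "leaves E = {}" "v \<in> V"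
  shows "card {e \<in> E. v \<in> e} = 2"
proof -
  from assms(2) have A: "A \<subseteq> V" and E: "E \<subseteq> cross A (V - A)" and con: "conn V E" and cE: "card E = card V"
    by (auto simp: unicyclic_def)
  have finE: "finite E" using finite_edges[OF assms(1) A E] .
  have ge2: "card {e \<in> E. v \<in> e} \<ge> 2" if "v \<in> V" for v
  proof -
    have "card {e \<in> E. v \<in> e} \<noteq> 0"
    proof
      assume "card {e \<in> E. v \<in> e} = 0"
      then have "{e \<in> E. v \<in> e} = {}" using finE by simp
      then have V: "{v} = V" using that by (intro connD[OF con]) auto
      then have "E = {}" using E A by (auto simp: cross_def)
      then show False using cE V by auto
    qed
    moreover have "card {e \<in> E. v \<in> e} \<noteq> 1" using assms(3) by (auto simp: leaves_def)
    ultimately show ?thesis by linarith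
  qed
  have "(\<Sum>v\<in>V. card {e \<in> E. v \<in> e}) = 2 * card E"
  proof (rule sum_multicount[OF assms(1) finE], safe)
    fix e assume e: "e \<in> E"
    then obtain a b where ab: "e = {a, b}" "a \<in> A" "b \<in> V - A" using E by (auto simp: cross_def)
    then have "{v \<in> V. v \<in> e} = {a, b}" using A by auto
    then show "card {v \<in> V. v \<in> e} = 2" using ab by (auto simp: card_insert_if)
  qed
  also have "\<dots> = (\<Sum>v\<in>V. 2)" using cE by simp
  finally have "(\<Sum>v\<in>V. 2) = (\<Sum>v\<in>V. card {e \<in> E. v \<in> e})" by simp
  from sum_mono_inv[OF this ge2 assms(4) assms(1)] show ?thesis by simp
qed

text \<open>Take a longest path starting with \<open>a\<close>, \<open>b\<close>. The second edge at
  its last vertex leads back into the path by maximality, and it can only end at the first vertex.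
  The resulting cycle uses up both edges at each of its vertices, so by connectedness it is the
  whole graph.\<close>

lemma two_regular_is_cyc:
  assumes fin: "finite V" and un: "(A, E) \<in> unicyclic V" and lf: "leaves E = {}"
    and ab: "a \<in> A" "b \<in> V - A" "{a, b} \<in> E"
  obtains xs where "distinct xs" "set xs = V" "length xs \<ge> 3" "even (length xs)" "evens xs = A" "cyc xs = E"
    "xs ! 0 = a" "xs ! 1 = b"
proof -
  from un have A: "A \<subseteq> V" and E: "E \<subseteq> cross A (V - A)" and con: "conn V E" and cE: "card E = card V"
    by (auto simp: unicyclic_def)
  have finE: "finite E" using finite_edges[OF fin A E] .
  have deg: "card {e \<in> E. v \<in> e} = 2" if "v \<in> V" for v using leafless_card_edges_at[OF fin un lf that] .
  define P where "P xs \<longleftrightarrow> distinct xs \<and> set xs \<subseteq> V \<and> 2 \<le> length xs \<and> xs ! 0 = a \<and> xs ! 1 = b \<and>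
    (\<forall>i. Suc i < length xs \<longrightarrow> {xs ! i, xs ! Suc i} \<in> E)" for xs
  have P0: "P [a, b]" using ab A by (auto simp: P_def less_Suc_eq)
  have bound: "length xs \<le> card V" if "P xs" for xs
    using that fin card_mono[of V "set xs"] by (auto simp: P_def distinct_card)
  obtain xs where xs: "P xs" and maxi: "\<And>ys. P ys \<Longrightarrow> length ys \<le> length xs"
  proof -
    have "\<exists>x. P x \<and> (\<forall>y. P y \<longrightarrow> length y \<le> length x)"
      by (rule ex_has_greatest_nat[of P "[a, b]" _ "Suc (card V)"]) (auto simp: P0 less_Suc_eq_le bound)
    then show ?thesis using that by blast
  qed
  define m where "m = length xs"
  have m2: "m \<ge> 2" and dist: "distinct xs" and setV: "set xs \<subseteq> V" and path: "\<And>i. Suc i < m \<Longrightarrow> {xs ! i, xs ! Suc i} \<in> E"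
    using xs by (auto simp: P_def m_def)
  have inV: "xs ! i \<in> V" if "i < m" for i using that setV by (auto simp: m_def)
  have neq: "xs ! i = xs ! j \<longleftrightarrow> i = j" if "i < m" "j < m" for i j
    using that dist by (auto simp: m_def nth_eq_iff_index_eq)
  define y where "y = xs ! (m - 1)"
  define e1 where "e1 = {xs ! (m - 2), y}"
  have e1: "e1 \<in> E" using path[of "m - 2"] m2 by (auto simp: e1_def y_def Suc_diff_Suc numeral_2_eq_2)
  have yV: "y \<in> V" using inV m2 by (simp add: y_def)
  obtain e2 where e2: "e2 \<in> E" "y \<in> e2" "e2 \<noteq> e1"
  proof -
    have "\<not> {e \<in> E. y \<in> e} \<subseteq> {e1}"
    proof
      assume "{e \<in> E. y \<in> e} \<subseteq> {e1}"
      then have "card {e \<in> E. y \<in> e} \<le> card {e1}" by (intro card_mono) auto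
      then show False using deg[OF yV] by simp
    qed
    then show ?thesis using that by blast
  qed
  obtain z where z: "e2 = {y, z}" "z \<noteq> y" "z \<in> V" "y \<in> A \<longleftrightarrow> z \<notin> A"
  proof -
    obtain p q where "e2 = {p, q}" "p \<in> A" "q \<in> V - A" using e2(1) E by (auto simp: cross_def)
    then show ?thesis using that e2(2) A by (cases "y = p") auto
  qed
  have "z \<in> set xs"
  proof (rule ccontr)
    assume "z \<notin> set xs"
    then have "P (xs @ [z])" using xs z e2(1) m2
      by (auto simp: P_def nth_append less_Suc_eq y_def m_def dest: sym[of "Suc _"])
    then show False using maxi[of "xs @ [z]"] by simp
  qed
  then obtain j where j: "j < m" "z = xs ! j" by (auto simp: in_set_conv_nth m_def)
  \<comment> \<open>The last index is excluded by \<open>z\<close> being different from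
    \<open>y\<close>, the one before it by \<open>e2\<close> being different from
    \<open>e1\<close>.\<close>
  have "j \<noteq> m - 1" using z(2) j(2) by (auto simp: y_def)
  moreover have "j \<noteq> m - 2" using e2(3) z(1) j(2) by (auto simp: e1_def insert_commute)
  ultimately have jm: "j < m - 2" using j(1) by linarith
  \<comment> \<open>At an inner vertex \<open>xs ! j\<close> the two path edges and
    \<open>e2\<close> would make three edges.\<close>
  have j0: "j = 0"
  proof (rule ccontr)
    assume "j \<noteq> 0"
    then obtain k where k: "j = Suc k" by (cases j) auto
    let ?T = "{{xs ! k, xs ! j}, {xs ! j, xs ! Suc j}, {y, xs ! j}}"
    have "?T \<subseteq> {e \<in> E. xs ! j \<in> e}"
      using path[of k] path[of j] jm k e2(1) z(1) j by auto
    from card_mono[OF _ this] have "card ?T \<le> 2" using deg[OF inV[OF j(1)]] finE by simp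
    have "k < m" "j < m" "Suc j < m" "m - 1 < m" "k \<noteq> Suc j" "k \<noteq> m - 1" "Suc j \<noteq> m - 1" "j \<noteq> m - 1" "k \<noteq> j"
      using jm k by auto
    then have "xs ! k \<noteq> xs ! Suc j" "xs ! k \<noteq> y" "xs ! Suc j \<noteq> y" "xs ! j \<noteq> y" "xs ! k \<noteq> xs ! j"
      unfolding y_def using neq by blast+
    then have "{xs ! k, xs ! j} \<noteq> {xs ! j, xs ! Suc j}" "{xs ! k, xs ! j} \<noteq> {y, xs ! j}"
      "{xs ! j, xs ! Suc j} \<noteq> {y, xs ! j}"
      by (auto simp: doubleton_eq_iff)
    then have "card ?T = 3" by simp
    with \<open>card ?T \<le> 2\<close> show False by simp
  qed
  then have m3: "m \<ge> 3" using jm by linarith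
  have cycE: "cyc xs \<subseteq> E"
  proof
    fix e assume "e \<in> cyc xs"
    then obtain i where i: "i < m" "e = cyc_edge xs i" by (auto simp: cyc_def m_def)
    show "e \<in> E"
    proof (cases "Suc i = m")
      case True
      then have "y = xs ! i" by (simp add: y_def flip: True)
      then have "e = {y, z}" using i j j0 True by (simp add: cyc_edge_def m_def)
      then show ?thesis using e2 z by simp
    next
      case False
      then show ?thesis using path[of i] i by (auto simp: cyc_edge_def m_def)
    qed
  qed
  \<comment> \<open>One set contains the other and both have two elements; hence no edge of
    \<open>E\<close> leads out of the cycle.\<close>
  have at: "{e \<in> E. v \<in> e} = {e \<in> cyc xs. v \<in> e}" if v: "v \<in> set xs" for v
  proof -
    obtain i where "i < m" "v = xs ! i" using v unfolding m_def by (metis in_set_conv_nth)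
    then have "card {e \<in> cyc xs. v \<in> e} = 2" using card_cyc_edges_at[OF dist, of i] m3 by (simp add: m_def)
    moreover have "{e \<in> cyc xs. v \<in> e} \<subseteq> {e \<in> E. v \<in> e}" using cycE by auto
    moreover have "card {e \<in> E. v \<in> e} = 2" "finite {e \<in> E. v \<in> e}" using deg[of v] v setV finE by auto
    ultimately show ?thesis using card_subset_eq[of "{e \<in> E. v \<in> e}" "{e \<in> cyc xs. v \<in> e}"] by metis
  qed
  have V: "set xs = V"
  proof (rule connD[OF con setV])
    show "set xs \<noteq> {}" using m3 by (auto simp: m_def)
    fix e assume "e \<in> E" "e \<inter> set xs \<noteq> {}"
    then obtain v where "v \<in> set xs" "v \<in> e" by blast
    then have "e \<in> cyc xs" using at[of v] \<open>e \<in> E\<close> by blast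
    then have "e \<subseteq> \<Union> (cyc xs)" by blast
    also note Union_cyc
    finally show "e \<subseteq> set xs" .
  qed
  have "E \<subseteq> cyc xs"
  proof
    fix e assume e: "e \<in> E"
    then obtain p q where "e = {p, q}" "p \<in> A" using E by (auto simp: cross_def)
    then show "e \<in> cyc xs" using at[of p] e V A by blast
  qed
  then have cyc: "cyc xs = E" using cycE by auto
  have cross: "u \<in> A \<longleftrightarrow> v \<notin> A" if uv: "{u, v} \<in> E" for u v
  proof -
    obtain p q where "{u, v} = {p, q}" "p \<in> A" "q \<in> V - A" using uv E unfolding cross_def by blast
    then show ?thesis by (auto simp: doubleton_eq_iff)
  qed
  have par: "i < m \<Longrightarrow> xs ! i \<in> A \<longleftrightarrow> even i" for i
  proof (induction i)
    case 0
    then show ?case using xs ab by (simp add: P_def)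
  next
    case (Suc i)
    then show ?case using cross[OF path[of i]] by auto
  qed
  have ev: "evens xs = A"
    using par V A by (auto simp: evens_def in_set_conv_nth m_def) (metis in_set_conv_nth subsetD)
  have "even m"
  proof -
    \<comment> \<open>Colours alternate along the path, and the closing edge joins the last vertex
      to \<open>a\<close>, which lies in \<open>A\<close>; so the last index is odd.\<close>
    have "y \<in> A \<longleftrightarrow> even (m - 1)" using par m3 by (simp add: y_def)
    moreover have "z \<in> A" using j j0 par[of 0] m3 by simp
    ultimately show ?thesis using z(4) m3 by auto
  qed
  moreover have "xs ! 0 = a" "xs ! 1 = b" using xs by (simp_all add: P_def)
  ultimately show ?thesis by (rule that[OF dist V m3[unfolded m_def] _ ev cyc, folded m_def])
qed

lemma cyc_in_unicyclic:
  assumes "distinct xs" "length xs \<ge> 3" "even (length xs)"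
  shows "(evens xs, cyc xs) \<in> unicyclic (set xs)" "leaves (cyc xs) = {}"
  using cyc_subset_cross[OF assms(1,3)] conn_cyc[of xs] card_cyc[OF assms(1,2)] distinct_card[OF assms(1)]
    leaves_cyc[OF assms(1,2)]
  by (auto simp: unicyclic_def evens_def)

text \<open>A proper cycle together with one of its edges is an ordering of the vertices: start at the
  end of the edge in the first colour class and traverse the cycle along the edge.\<close>

lemma card_leafless:
  assumes "finite V" "V \<noteq> {}"
  shows "card {(A, E) \<in> unicyclic V. leaves E = {}}
    = (if even (card V) \<and> card V \<ge> 4 then fact (card V - 1) else 0)"
    (is "card ?D = _")
proof -
  define L where "L = {xs \<in> permutations_of_set V. even (length xs) \<and> length xs \<ge> 3}"
  have Lset: "set xs = V" "distinct xs" "length xs = card V" if "xs \<in> L" for xs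
    using that by (auto simp: L_def permutations_of_set_def distinct_card)
  have "bij_betw (\<lambda>xs. ((evens xs, cyc xs), cyc_edge xs 0)) L (Sigma ?D snd)"
  proof (rule bij_betw_imageI)
    show "inj_on (\<lambda>xs. ((evens xs, cyc xs), cyc_edge xs 0)) L"
    proof (rule inj_onI)
      fix xs ys assume xs: "xs \<in> L" and ys: "ys \<in> L"
        and eq: "((evens xs, cyc xs), cyc_edge xs 0) = ((evens ys, cyc ys), cyc_edge ys 0)"
      have len: "length xs \<ge> 3" "length ys = length xs"
        using xs Lset(3)[OF xs] Lset(3)[OF ys] by (simp_all add: L_def)
      have l: "0 < length xs" "1 < length ys" using len by linarith+
      \<comment> \<open>The marked edge is known only as a set. Its end in the first colour class
        must be entry 0, which fixes the direction of traversal.\<close>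
      have "{xs ! 0, xs ! 1} = {ys ! 0, ys ! 1}" using eq len by (auto simp: cyc_edge_def split: if_splits)
      moreover have "xs ! 0 \<in> evens xs" "ys ! 1 \<notin> evens ys"
        using nth_mem_evens[OF Lset(2)[OF xs] l(1)] nth_mem_evens[OF Lset(2)[OF ys] l(2)] by simp_all
      moreover have "evens xs = evens ys" using eq by simp
      ultimately have "xs ! 0 = ys ! 0" "xs ! 1 = ys ! 1" unfolding doubleton_eq_iff by metis+
      then show "xs = ys"
        using cyc_determines_list[OF Lset(2)[OF xs] Lset(2)[OF ys] len(2)[symmetric] len(1)] eq by blast
    qed
    show "(\<lambda>xs. ((evens xs, cyc xs), cyc_edge xs 0)) ` L = Sigma ?D snd"
    proof (intro equalityI subsetI)
      fix t assume "t \<in> (\<lambda>xs. ((evens xs, cyc xs), cyc_edge xs 0)) ` L"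
      then obtain xs where xs: "xs \<in> L" and t: "t = ((evens xs, cyc xs), cyc_edge xs 0)" by blast
      have "length xs \<ge> 3" "even (length xs)" using xs by (simp_all add: L_def)
      from cyc_in_unicyclic[OF Lset(2)[OF xs] this] have "(evens xs, cyc xs) \<in> ?D"
        unfolding Lset(1)[OF xs] by simp
      moreover have "cyc_edge xs 0 \<in> cyc xs" 
      proof -
        have "0 < length xs" using \<open>length xs \<ge> 3\<close> by linarith
        then show ?thesis unfolding cyc_def by (intro imageI) blast
      qed
      ultimately show "t \<in> Sigma ?D snd" using t by simp
    next
      fix t assume "t \<in> Sigma ?D snd"
      then obtain A E e where t: "t = ((A, E), e)" "(A, E) \<in> unicyclic V" "leaves E = {}" "e \<in> E" by auto
      then obtain a b where ab: "e = {a, b}" "a \<in> A" "b \<in> V - A"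
        by (auto simp: unicyclic_def cross_def)
      then obtain xs where xs: "distinct xs" "set xs = V" "length xs \<ge> 3" "even (length xs)"
        "evens xs = A" "cyc xs = E" "xs ! 0 = a" "xs ! 1 = b"
        using two_regular_is_cyc[OF assms(1) t(2,3), of a b] t(4) by auto
      then have "t = ((evens xs, cyc xs), cyc_edge xs 0)" using t ab by (auto simp: cyc_edge_def)
      moreover have "xs \<in> L" using xs by (auto simp: L_def permutations_of_set_def)
      ultimately show "t \<in> (\<lambda>xs. ((evens xs, cyc xs), cyc_edge xs 0)) ` L" by blast
    qed
  qed
  then have "card L = card (Sigma ?D snd)" by (rule bij_betw_same_card)
  also have "\<dots> = (\<Sum>p\<in>?D. card (snd p))"
  proof (rule card_SigmaI)
    show "finite ?D" using finite_unicyclic[OF assms(1)] by (rule finite_subset[rotated]) auto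
    show "\<forall>p\<in>?D. finite (snd p)" using finite_edges[OF assms(1)] by (auto simp: unicyclic_def)
  qed
  also have "\<dots> = (\<Sum>p\<in>?D. card V)" by (rule sum.cong) (auto simp: unicyclic_def)
  \<comment> \<open>Every graph here has \<open>card V\<close> edges to mark, so the number of
    orderings overcounts the graphs by exactly this factor.\<close>
  finally have main: "card L = card ?D * card V" by simp
  have pos: "card V > 0" using assms by (simp add: card_gt_0_iff)
  show ?thesis
  proof (cases "even (card V) \<and> card V \<ge> 4")
    case True
    then have "L = permutations_of_set V"
      by (auto simp: L_def permutations_of_set_def distinct_card)
    then have "card L = card V * fact (card V - 1)"
      using assms(1) pos by (simp add: card_permutations_of_set fact_reduce)
    then show ?thesis using main pos True by simp
  next
    case False
    have "xs \<notin> L" for xs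
    proof
      assume xs: "xs \<in> L"
      then have "even (length xs)" "length xs \<ge> 3" by (simp_all add: L_def)
      then have "even (card V)" "card V \<ge> 3" using Lset(3)[OF xs] by simp_all
      moreover have "card V \<noteq> 3" using \<open>even (card V)\<close> by auto
      ultimately have "card V \<ge> 4" by simp
      then show False using False \<open>even (card V)\<close> by simp
    qed
    then have "L = {}" by blast
    then have "card ?D = 0" using main pos by simp
    then show ?thesis using False by simp
  qed
qed

section \<open>Attaching leaves\<close>

definition with_leaves :: "'a set \<Rightarrow> 'a set \<Rightarrow> ('a set \<times> 'a set set) set" where
  "with_leaves V L = {(A, E) \<in> unicyclic V. L \<subseteq> leaves E}"

lemma conn_add_leaf:
  assumes "conn V E" "\<Union> E \<subseteq> V" "p \<in> V" "l \<notin> V"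
  shows "conn (insert l V) (insert {l, p} E)"
  unfolding conn_def
proof (intro allI impI)
  fix S assume S: "S \<subseteq> insert l V" "S \<noteq> {}" "\<forall>e\<in>insert {l, p} E. e \<inter> S \<noteq> {} \<longrightarrow> e \<subseteq> S"
  then have lp: "l \<in> S \<longleftrightarrow> p \<in> S" by auto
  have "V \<inter> S = V"
  proof (rule connD[OF assms(1)])
    show "V \<inter> S \<noteq> {}" using S(1,2) lp assms(3) by blast
  next
    fix e assume e: "e \<in> E" "e \<inter> (V \<inter> S) \<noteq> {}"
    then have "e \<subseteq> S" using S(3) by blast
    then show "e \<subseteq> V \<inter> S" using e(1) assms(2) by blast
  qed blast
  then show "S = insert l V" using lp S(1) assms(3) by blast
qed

lemma conn_remove_leaf:
  assumes "conn (insert l V) (insert {l, p} E)" "p \<in> V" "l \<notin> V" "\<Union> E \<subseteq> V"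
  shows "conn V E"
  unfolding conn_def
proof (intro allI impI)
  fix S assume S: "S \<subseteq> V" "S \<noteq> {}" "\<forall>e\<in>E. e \<inter> S \<noteq> {} \<longrightarrow> e \<subseteq> S"
  \<comment> \<open>Adding \<open>l\<close> exactly when \<open>p\<close> is present keeps the set
    closed under the extra edge.\<close>
  define S' where "S' = (if p \<in> S then insert l S else S)"
  have "S' = insert l V"
  proof (rule connD[OF assms(1)])
    show "S' \<subseteq> insert l V" "S' \<noteq> {}" using S by (auto simp: S'_def)
    fix e assume "e \<in> insert {l, p} E" "e \<inter> S' \<noteq> {}"
    then consider "e = {l, p}" "e \<inter> S' \<noteq> {}" | "e \<in> E" "e \<inter> S \<noteq> {}"
      using assms(3,4) unfolding S'_def by (auto split: if_splits)
    then show "e \<subseteq> S'"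
    proof cases
      case 1
      then show ?thesis using S(1) assms(3) by (auto simp: S'_def split: if_splits)
    next
      case 2
      then have "e \<subseteq> S" using S(3) by blast
      then show ?thesis by (auto simp: S'_def)
    qed
  qed
  then show "S = V" using S(1) assms(3) by (auto simp: S'_def split: if_splits)
qed

text \<open>The colour of the new leaf \<open>l\<close> is forced to be opposite to that of its
  neighbour \<open>p\<close>.\<close>

definition attach :: "'a \<Rightarrow> ('a set \<times> 'a set set) \<times> 'a \<Rightarrow> 'a set \<times> 'a set set" where
  "attach l = (\<lambda>((A, E), p). (if p \<in> A then A else insert l A, insert {l, p} E))"

lemma unicyclic_Union: "(A, E) \<in> unicyclic V \<Longrightarrow> \<Union> E \<subseteq> V"
  using cross_subset[of _ A "V - A"] by (auto simp: unicyclic_def)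

text \<open>Everything can be read off the result: the old edges are those avoiding
  \<open>l\<close>, \<open>p\<close> is the other end of the edge at \<open>l\<close>, and the old
  colour class is the new one without \<open>l\<close>.\<close>

lemma inj_on_attach:
  assumes "l \<notin> V"
  shows "inj_on (attach l) (with_leaves V L \<times> (V - L))"
proof (rule inj_onI)
  fix x y assume x: "x \<in> with_leaves V L \<times> (V - L)" and y: "y \<in> with_leaves V L \<times> (V - L)"
    and eq: "attach l x = attach l y"
  obtain A E p where xs: "x = ((A, E), p)" by (metis surj_pair)
  obtain A' E' p' where ys: "y = ((A', E'), p')" by (metis surj_pair)
  have u: "(A, E) \<in> unicyclic V" "p \<in> V" "(A', E') \<in> unicyclic V" "p' \<in> V"
    using x y by (auto simp: xs ys with_leaves_def)
  have l: "l \<notin> \<Union> E" "l \<notin> \<Union> E'" using unicyclic_Union u assms by blast+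
  have E: "insert {l, p} E = insert {l, p'} E'" using eq by (auto simp: attach_def xs ys)
  then have "{e \<in> insert {l, p} E. l \<notin> e} = {e \<in> insert {l, p'} E'. l \<notin> e}" by simp
  moreover have "{e \<in> insert {l, p} E. l \<notin> e} = E" "{e \<in> insert {l, p'} E'. l \<notin> e} = E'"
    using l by blast+
  ultimately have "E = E'" by simp
  have "{l, p} \<in> insert {l, p'} E'" using E by blast
  moreover have "{l, p} \<notin> E'" using l(2) by (meson UnionI insertI1)
  ultimately have "{l, p} = {l, p'}" by simp
  then have "p = p'" by (auto simp: doubleton_eq_iff)
  have "(if p \<in> A then A else insert l A) - {l} = (if p' \<in> A' then A' else insert l A') - {l}"
    using eq by (auto simp: attach_def xs ys)
  moreover have "l \<notin> A" "l \<notin> A'" using u assms by (auto simp: unicyclic_def)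
  ultimately have "A = A'" by (auto split: if_splits)
  then show "x = y" using \<open>E = E'\<close> \<open>p = p'\<close> by (simp add: xs ys)
qed

text \<open>As \<open>p\<close> is outside \<open>L\<close>, the new edge does not touch
  \<open>L\<close>, so the vertices of \<open>L\<close> keep degree 1.\<close>

lemma attach_in_with_leaves:
  assumes "finite V" "l \<notin> V" "(A, E) \<in> with_leaves V L" "p \<in> V - L" "L \<subseteq> V"
  shows "attach l ((A, E), p) \<in> with_leaves (insert l V) (insert l L)"
proof -
  have un: "(A, E) \<in> unicyclic V" and L: "L \<subseteq> leaves E" using assms by (auto simp: with_leaves_def)
  then have A: "A \<subseteq> V" and E: "E \<subseteq> cross A (V - A)" and con: "conn V E" and cE: "card E = card V"
    by (auto simp: unicyclic_def)
  have UE: "\<Union> E \<subseteq> V" using unicyclic_Union[OF un] .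
  define A' where "A' = (if p \<in> A then A else insert l A)"
  have A': "A' \<subseteq> insert l V" using A by (auto simp: A'_def)
  have lA: "l \<notin> A" using A assms(2) by blast
  have E': "insert {l, p} E \<subseteq> cross A' (insert l V - A')"
  proof -
    have "A \<subseteq> A'" "V - A \<subseteq> insert l V - A'" using assms(2) by (auto simp: A'_def)
    then have "cross A (V - A) \<subseteq> cross A' (insert l V - A')" unfolding cross_def by blast
    moreover have "{l, p} \<in> cross A' (insert l V - A')"
    proof (cases "p \<in> A")
      case True
      then have "{l, p} = {p, l}" "p \<in> A'" "l \<in> insert l V - A'" using lA by (auto simp: A'_def)
      then show ?thesis unfolding cross_def by blast
    next
      case False
      then have "l \<in> A'" "p \<in> insert l V - A'" using assms(2,4) by (auto simp: A'_def)
      then show ?thesis unfolding cross_def by blast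
    qed
    ultimately show ?thesis using E by blast
  qed
  have con': "conn (insert l V) (insert {l, p} E)" using conn_add_leaf[OF con UE _ assms(2)] assms(4) by blast
  have new: "{l, p} \<notin> E" using UE assms(2) by blast
  have card: "card (insert {l, p} E) = card (insert l V)"
    using new cE assms(1,2) finite_edges[OF assms(1) A E] by simp
  have "insert l L \<subseteq> leaves (insert {l, p} E)"
  proof
    fix v assume "v \<in> insert l L"
    then consider "v = l" | "v \<in> L" by blast
    then show "v \<in> leaves (insert {l, p} E)"
    proof cases
      case 1
      then have "{e \<in> insert {l, p} E. v \<in> e} = {{l, p}}" using UE assms(2) by blast
      then show ?thesis by (simp add: leaves_def)
    next
      case 2
      then have "v \<notin> {l, p}" using assms(2,4,5) by blast
      then have "{e \<in> insert {l, p} E. v \<in> e} = {e \<in> E. v \<in> e}" by blast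
      moreover have "v \<in> leaves E" using 2 L by blast
      ultimately show ?thesis unfolding leaves_def by simp
    qed
  qed
  then show ?thesis using A' E' con' card
    by (simp add: attach_def with_leaves_def unicyclic_def flip: A'_def)
qed

lemma with_leaves_in_attach:
  assumes "finite V" "l \<notin> V" "L \<subseteq> V" "(A', E') \<in> with_leaves (insert l V) (insert l L)"
  shows "(A', E') \<in> attach l ` (with_leaves V L \<times> (V - L))"
proof -
  have un: "(A', E') \<in> unicyclic (insert l V)" and L: "insert l L \<subseteq> leaves E'"
    using assms by (auto simp: with_leaves_def)
  then have A': "A' \<subseteq> insert l V" and E': "E' \<subseteq> cross A' (insert l V - A')"
    and con: "conn (insert l V) E'" and cE: "card E' = card (insert l V)"
    by (auto simp: unicyclic_def)
  have finE: "finite E'" using finite_edges[OF _ A' E'] assms(1) by simp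
  have "card {e \<in> E'. l \<in> e} = 1" using L by (auto simp: leaves_def)
  then obtain e0 where e0: "{e \<in> E'. l \<in> e} = {e0}" by (rule card_1_singletonE)
  then have e0E: "e0 \<in> E'" "l \<in> e0" by blast+
  then obtain p where p: "e0 = {l, p}" "p \<in> V" "p \<in> A' \<longleftrightarrow> l \<notin> A'"
  proof -
    obtain a b where "e0 = {a, b}" "a \<in> A'" "b \<in> insert l V - A'"
      using e0E(1) E' unfolding cross_def by blast
    then show ?thesis using that[of a] that[of b] e0E(2) A' by (cases "l = a") (auto simp: insert_commute)
  qed
  \<comment> \<open>Two adjacent leaves form a whole component, so the graph would have two vertices
    and at most one edge, against the equality of the two numbers.\<close>
  have "p \<notin> L"
  proof
    assume "p \<in> L"
    then have "card {e \<in> E'. p \<in> e} = 1" using L by (auto simp: leaves_def)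
    then obtain e1 where "{e \<in> E'. p \<in> e} = {e1}" by (rule card_1_singletonE)
    moreover have "e0 \<in> {e \<in> E'. p \<in> e}" using e0E p by simp
    ultimately have at_p: "{e \<in> E'. p \<in> e} = {e0}" by simp
    have V: "{l, p} = insert l V"
    proof (rule connD[OF con])
      fix e assume "e \<in> E'" "e \<inter> {l, p} \<noteq> {}"
      then have "e = e0" using e0 at_p by blast
      then show "e \<subseteq> {l, p}" using p by simp
    qed (use p in auto)
    have "E' \<subseteq> {e0}"
    proof
      fix e assume e: "e \<in> E'"
      then obtain a b where ab: "e = {a, b}" "a \<in> insert l V" using E' A' unfolding cross_def by blast
      then have "a = l \<or> a = p" using V[symmetric] by simp
      then have "e \<in> {e \<in> E'. l \<in> e} \<union> {e \<in> E'. p \<in> e}" using e ab(1) by auto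
      then show "e \<in> {e0}" unfolding e0 at_p by simp
    qed
    then have "card E' \<le> 1" using card_mono[of "{e0}" E'] by simp
    moreover have "card (insert l V) = 2" using p(2) assms(2) by (subst V[symmetric]) (auto simp: card_insert_if)
    ultimately show False using cE by simp
  qed
  define A where "A = A' - {l}"
  define E where "E = E' - {e0}"
  have insE: "insert {l, p} E = E'" using e0E p(1) by (auto simp: E_def)
  have lE: "l \<notin> e" if "e \<in> E" for e using that e0 by (auto simp: E_def)
  have E: "E \<subseteq> cross A (V - A)"
  proof
    fix e assume e: "e \<in> E"
    then obtain a b where ab: "e = {a, b}" "a \<in> A'" "b \<in> insert l V - A'"
      using E' unfolding E_def cross_def by blast
    then have "a \<in> A" "b \<in> V - A" using lE[OF e] by (auto simp: A_def)
    then show "e \<in> cross A (V - A)" using ab(1) unfolding cross_def by blast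
  qed
  have AV: "A \<subseteq> V" using A' by (auto simp: A_def)
  have "\<Union> E \<subseteq> V" using E AV cross_subset by blast
  then have "conn V E" using conn_remove_leaf[of l V p E] con insE p(2) assms(2) by simp
  moreover have "card E = card V" using cE finE e0E(1) assms(1,2) by (simp add: E_def)
  ultimately have "(A, E) \<in> unicyclic V" using E AV by (simp add: unicyclic_def)
  moreover have "L \<subseteq> leaves E"
  proof
    fix v assume v: "v \<in> L"
    then have "v \<notin> e0" using p \<open>p \<notin> L\<close> assms(2,3) by blast
    then have "{e \<in> E. v \<in> e} = {e \<in> E'. v \<in> e}" by (auto simp: E_def)
    moreover have "v \<in> leaves E'" using v L by blast
    ultimately show "v \<in> leaves E" unfolding leaves_def by simp
  qed
  ultimately have "((A, E), p) \<in> with_leaves V L \<times> (V - L)"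
    using p(2) \<open>p \<notin> L\<close> by (simp add: with_leaves_def)
  moreover have "attach l ((A, E), p) = (A', E')"
    using p assms(2) insE by (auto simp: attach_def A_def)
  ultimately show ?thesis by (metis image_eqI)
qed

lemma card_with_leaves_insert:
  assumes "finite V" "l \<notin> V" "L \<subseteq> V"
  shows "card (with_leaves (insert l V) (insert l L)) = card (with_leaves V L) * card (V - L)"
proof -
  have "with_leaves (insert l V) (insert l L) = attach l ` (with_leaves V L \<times> (V - L))"
  proof (intro equalityI subsetI)
    fix x assume "x \<in> with_leaves (insert l V) (insert l L)"
    then show "x \<in> attach l ` (with_leaves V L \<times> (V - L))"
      using with_leaves_in_attach[OF assms, of "fst x" "snd x"] by simp
  next
    fix x assume "x \<in> attach l ` (with_leaves V L \<times> (V - L))"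
    then obtain A E p where "x = attach l ((A, E), p)" "(A, E) \<in> with_leaves V L" "p \<in> V - L" by auto
    then show "x \<in> with_leaves (insert l V) (insert l L)"
      using attach_in_with_leaves[OF assms(1,2) _ _ assms(3)] by simp
  qed
  then show ?thesis using card_image[OF inj_on_attach[OF assms(2)]] by (simp add: card_cartesian_product)
qed

text \<open>The leaves are attached one at a time. Each new one may be hung on any vertex that is
  not a prescribed leaf, and these vertices always form \<open>W\<close>.\<close>

lemma card_with_leaves:
  assumes "finite L" "finite W" "L \<inter> W = {}"
  shows "card (with_leaves (L \<union> W) L) = card (unicyclic W) * card W ^ card L"
  using assms
proof (induction L rule: finite_induct)
  case empty
  then show ?case by (simp add: with_leaves_def)
next
  case (insert l L)
  have "card (with_leaves (insert l (L \<union> W)) (insert l L)) = card (with_leaves (L \<union> W) L) * card (L \<union> W - L)"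
    using insert by (intro card_with_leaves_insert) auto
  also have "L \<union> W - L = W" using insert by blast
  finally show ?case using insert by simp
qed

section \<open>Inclusion-exclusion over sets of leaves\<close>

lemma alternating_sum_Pow:
  assumes "finite S"
  shows "(\<Sum>L\<in>Pow S. (-1) ^ card L) = (if S = {} then 1 else 0 :: real)"
proof -
  have "(\<Sum>L\<in>Pow S. (-1) ^ card L) = (\<Prod>x\<in>S. 1 - 1 :: real)"
    by (subst prod_diff_conv_sum[OF assms]) simp
  then show ?thesis using assms by (simp add: card_gt_0_iff)
qed

lemma sum_Pow_card:
  fixes g :: "nat \<Rightarrow> 'b :: semiring_1"
  assumes "finite V"
  shows "(\<Sum>L\<in>Pow V. g (card L)) = (\<Sum>l\<le>card V. of_nat (card V choose l) * g l)"
proof -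
  have "(\<Sum>L\<in>Pow V. g (card L)) = (\<Sum>l\<le>card V. \<Sum>L | L \<in> Pow V \<and> card L = l. g (card L))"
    using assms by (intro sum.group[symmetric]) (auto intro: card_mono)
  also have "\<dots> = (\<Sum>l\<le>card V. of_nat (card V choose l) * g l)"
    using assms by (intro sum.cong) (auto simp: n_subsets)
  finally show ?thesis .
qed

text \<open>The pairs of a graph and a subset \<open>L\<close> of its leaves are counted with sign
  in both orders. For fixed \<open>L\<close> this gives the graphs in
  \<open>with_leaves V L\<close>; for a fixed graph the signs cancel unless it has no leaf.\<close>

lemma leafless_inclusion_exclusion:
  assumes "finite V"
  shows "(\<Sum>L\<in>Pow V. (-1) ^ card L * real (card (unicyclic (V - L)) * (card V - card L) ^ card L))
    = real (card {(A, E) \<in> unicyclic V. leaves E = {}})"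
proof -
  note fin = finite_unicyclic[OF assms]
  have "(\<Sum>L\<in>Pow V. (-1) ^ card L * real (card (unicyclic (V - L)) * (card V - card L) ^ card L))
      = (\<Sum>L\<in>Pow V. \<Sum>p\<in>unicyclic V. if L \<subseteq> leaves (snd p) then (-1) ^ card L else 0)"
  proof (rule sum.cong)
    fix L assume "L \<in> Pow V"
    then have L: "L \<subseteq> V" "finite L" using assms by (auto dest: finite_subset)
    have "L \<union> (V - L) = V" "card (V - L) = card V - card L" using L by (auto simp: card_Diff_subset)
    then have "card (unicyclic (V - L)) * (card V - card L) ^ card L = card (with_leaves V L)"
      using card_with_leaves[OF L(2), of "V - L"] assms by simp
    also have "with_leaves V L = {p \<in> unicyclic V. L \<subseteq> leaves (snd p)}" by (auto simp: with_leaves_def)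
    finally show "(-1) ^ card L * real (card (unicyclic (V - L)) * (card V - card L) ^ card L)
        = (\<Sum>p\<in>unicyclic V. if L \<subseteq> leaves (snd p) then (-1) ^ card L else 0)"
      using fin by (simp add: sum.If_cases Int_def)
  qed simp
  also have "\<dots> = (\<Sum>p\<in>unicyclic V. \<Sum>L\<in>Pow V. if L \<subseteq> leaves (snd p) then (-1) ^ card L else 0)"
    by (rule sum.swap)
  also have "\<dots> = (\<Sum>p\<in>unicyclic V. if leaves (snd p) = {} then 1 else 0)"
  proof (rule sum.cong)
    fix p assume "p \<in> unicyclic V"
    then have sub: "leaves (snd p) \<subseteq> V" using leaves_subset[of "fst p" "snd p" V] by simp
    have "(\<Sum>L\<in>Pow V. if L \<subseteq> leaves (snd p) then (-1) ^ card L else 0) = (\<Sum>L\<in>Pow (leaves (snd p)). (-1 :: real) ^ card L)"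
      using assms sub by (intro sum.mono_neutral_cong_right) auto
    then show "(\<Sum>L\<in>Pow V. if L \<subseteq> leaves (snd p) then (-1) ^ card L else 0) = (if leaves (snd p) = {} then 1 else 0 :: real)"
      using alternating_sum_Pow[OF finite_subset[OF sub assms]] by simp
  qed simp
  also have "\<dots> = real (card {p \<in> unicyclic V. leaves (snd p) = {}})"
    using fin by (simp add: sum.If_cases Int_def)
  also have "{p \<in> unicyclic V. leaves (snd p) = {}} = {(A, E) \<in> unicyclic V. leaves E = {}}" by auto
  finally show ?thesis .
qed

text \<open>Both sides have the same leaf transform, namely \<open>coloured_cycles\<close>. In it
  the term of the empty \<open>L\<close> is the value at \<open>V\<close> itself, and the remaining
  terms involve smaller vertex sets, so strong induction gives equality.\<close>

lemma card_unicyclic: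
  assumes "finite V" "V \<noteq> {}"
  shows "real (card (unicyclic V)) = cycle_sum (card V)"
  using assms
proof (induction "card V" arbitrary: V rule: less_induct)
  case less
  define n where "n = card V"
  have n: "n > 0" using less.prems by (simp add: n_def card_gt_0_iff)
  define f where "f L = (-1) ^ card L * real (card (unicyclic (V - L)) * (n - card L) ^ card L)" for L :: "'a set"
  define g where "g L = (-1) ^ card L * (real (n - card L) ^ card L * cycle_sum (n - card L))" for L :: "'a set"
  have "sum f (Pow V) = coloured_cycles n"
    using leafless_inclusion_exclusion[OF less.prems(1)] card_leafless[OF less.prems]
    by (simp add: f_def n_def coloured_cycles_def)
  also have "\<dots> = sum g (Pow V)"
    using leaf_transform_cycle_sum[OF n]
      sum_Pow_card[OF less.prems(1), of "\<lambda>l. (-1) ^ l * (real (n - l) ^ l * cycle_sum (n - l))"]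
    by (simp add: g_def n_def mult_ac)
  finally have "sum f (Pow V) = sum g (Pow V)" .
  moreover have "sum f (Pow V) = f {} + sum f (Pow V - {{}})" "sum g (Pow V) = g {} + sum g (Pow V - {{}})"
    using less.prems(1) by (auto intro!: sum.remove)
  moreover have "sum f (Pow V - {{}}) = sum g (Pow V - {{}})"
  proof (rule sum.cong)
    fix L assume "L \<in> Pow V - {{}}"
    then have L: "L \<subseteq> V" "L \<noteq> {}" "finite L" using less.prems by (auto dest: finite_subset)
    have cd: "card (V - L) = n - card L" using L by (simp add: card_Diff_subset n_def)
    show "f L = g L"
    \<comment> \<open>The induction hypothesis does not cover \<open>V - L = {}\<close>, where the
      counts are 1 and \<open>cycle_sum 0\<close>, which is 0. Both are multiplied by a positive
      power of 0.\<close>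
    proof (cases "L = V")
      case True
      then show ?thesis using n by (simp add: f_def g_def n_def)
    next
      case False
      then have "V - L \<noteq> {}" using L by blast
      moreover have "card (V - L) < card V" using L less.prems(1) by (intro psubset_card_mono) auto
      ultimately have "real (card (unicyclic (V - L))) = cycle_sum (n - card L)"
        using less.hyps[of "V - L"] less.prems(1) cd by simp
      then show ?thesis by (simp add: f_def g_def)
    qed
  qed simp
  ultimately show ?case by (simp add: f_def g_def n_def)
qed

section \<open>Graphs on two labelled sides\<close>

text \<open>The vertices reachable from \<open>u\<close> form a set that no edge leaves; conversely
  such a set contains everything reachable from any of its elements.\<close>

lemma connected_graph_of_iff:
  assumes "V \<noteq> {}" "\<And>e. e \<in> E \<Longrightarrow> \<exists>u\<in>V. \<exists>v\<in>V. e = {u, v}"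
  shows "Digraph_Component.connected (with_proj (graph_of V E)) \<longleftrightarrow> conn V E"
proof -
  define R where "R = {(u, v). {u, v} \<in> E}"
  \<comment> \<open>\<open>graph_of\<close> already has both arcs of every edge, so symmetrizing
    adds nothing.\<close>
  have arcs: "parcs (mk_symmetric (with_proj (graph_of V E))) = R"
    by (auto simp: parcs_mk_symmetric graph_of_def R_def insert_commute)
  have "Digraph_Component.connected (with_proj (graph_of V E)) \<longleftrightarrow> (\<forall>u\<in>V. \<forall>v\<in>V. (u, v) \<in> rtrancl_on V R)"
    using assms(1) by (simp add: Digraph_Component.connected_def strongly_connected_def reachable_def arcs)
      (simp add: graph_of_def)
  also have "\<dots> \<longleftrightarrow> conn V E"
  proof
    assume reach: "\<forall>u\<in>V. \<forall>v\<in>V. (u, v) \<in> rtrancl_on V R"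
    show "conn V E" unfolding conn_def
    proof (intro allI impI)
      fix S assume S: "S \<subseteq> V" "S \<noteq> {}" "\<forall>e\<in>E. e \<inter> S \<noteq> {} \<longrightarrow> e \<subseteq> S"
      then obtain x where x: "x \<in> S" by blast
      have "v \<in> S" if "v \<in> V" for v
      proof -
        have "(x, v) \<in> rtrancl_on V R" using reach x S(1) that by blast
        then show "v \<in> S"
        proof (induction rule: rtrancl_on_induct)
          case (step y z)
          then have "{y, z} \<in> E" "{y, z} \<inter> S \<noteq> {}" by (auto simp: R_def)
          then have "{y, z} \<subseteq> S" by (rule S(3)[rule_format])
          then show ?case by simp
        qed (rule x)
      qed
      then show "S = V" using S(1) by blast
    qed
  next
    assume con: "conn V E"
    show "\<forall>u\<in>V. \<forall>v\<in>V. (u, v) \<in> rtrancl_on V R"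
    proof
      fix u assume u: "u \<in> V"
      have "{v \<in> V. (u, v) \<in> rtrancl_on V R} = V"
      proof (rule connD[OF con])
        show "{v \<in> V. (u, v) \<in> rtrancl_on V R} \<noteq> {}" using u by auto
        fix e assume e: "e \<in> E" "e \<inter> {v \<in> V. (u, v) \<in> rtrancl_on V R} \<noteq> {}"
        obtain a b where ab: "a \<in> V" "b \<in> V" "e = {a, b}" using assms(2)[OF e(1)] by blast
        then have "(a, b) \<in> R" "(b, a) \<in> R" using e(1) by (auto simp: R_def insert_commute)
        then show "e \<subseteq> {v \<in> V. (u, v) \<in> rtrancl_on V R}"
          using e(2) ab rtrancl_on_into_rtrancl_on[of u a V R b] rtrancl_on_into_rtrancl_on[of u b V R a] by auto
      qed blast
      then show "\<forall>v\<in>V. (u, v) \<in> rtrancl_on V R" by blast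
    qed
  qed
  finally show ?thesis .
qed

section \<open>Counting with both colour classes fixed\<close>

definition bip_unicyclic :: "'a set \<Rightarrow> 'a set \<Rightarrow> 'a set set set" where
  "bip_unicyclic A B = {E. E \<subseteq> cross A B \<and> conn (A \<union> B) E \<and> card E = card A + card B}"

lemma finite_bip_unicyclic: "finite A \<Longrightarrow> finite B \<Longrightarrow> finite (bip_unicyclic A B)"
  by (rule finite_subset[of _ "Pow (cross A B)"]) (auto simp: bip_unicyclic_def finite_cross)

lemma conn_image:
  assumes "conn V E" "\<Union> E \<subseteq> V"
  shows "conn (f ` V) ((`) f ` E)"
  unfolding conn_def
proof (intro allI impI)
  fix S assume S: "S \<subseteq> f ` V" "S \<noteq> {}" "\<forall>e\<in>(`) f ` E. e \<inter> S \<noteq> {} \<longrightarrow> e \<subseteq> S"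
  have "{v \<in> V. f v \<in> S} = V"
  proof (rule connD[OF assms(1)])
    show "{v \<in> V. f v \<in> S} \<noteq> {}" using S(1,2) by blast
    fix e assume e: "e \<in> E" "e \<inter> {v \<in> V. f v \<in> S} \<noteq> {}"
    then have "f ` e \<in> (`) f ` E" "f ` e \<inter> S \<noteq> {}" by blast+
    then have "f ` e \<subseteq> S" using S(3) by blast
    then show "e \<subseteq> {v \<in> V. f v \<in> S}" using e(1) assms(2) by blast
  qed blast
  then show "S = f ` V" using S(1) by blast
qed

text \<open>An inequality for every injection suffices: applied to the inverse map as well, it
  yields the invariance under relabelling in \<open>card_bip_unicyclic_image\<close>.\<close>

lemma card_bip_unicyclic_le:
  assumes "finite A" "finite B" "inj_on f (A \<union> B)"
  shows "card (bip_unicyclic A B) \<le> card (bip_unicyclic (f ` A) (f ` B))"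
proof (rule card_inj_on_le)
  have sub: "E \<subseteq> Pow (A \<union> B)" if "E \<in> bip_unicyclic A B" for E
    using that cross_subset[of _ A B] by (auto simp: bip_unicyclic_def)
  have inj1: "inj_on ((`) f) (Pow (A \<union> B))" using assms(3) by (rule inj_on_image_Pow)
  show "inj_on ((`) ((`) f)) (bip_unicyclic A B)"
    by (rule inj_on_subset[OF inj_on_image_Pow[OF inj1]]) (use sub in blast)
  show "finite (bip_unicyclic (f ` A) (f ` B))" using assms by (intro finite_bip_unicyclic) auto
  show "(`) ((`) f) ` bip_unicyclic A B \<subseteq> bip_unicyclic (f ` A) (f ` B)"
  proof
    fix F assume "F \<in> (`) ((`) f) ` bip_unicyclic A B"
    then obtain E where E: "E \<in> bip_unicyclic A B" and F: "F = (`) f ` E" by blast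
    have "F \<subseteq> cross (f ` A) (f ` B)"
    proof
      fix e assume "e \<in> F"
      then obtain a b where "e = f ` {a, b}" "a \<in> A" "b \<in> B" using E F by (auto simp: bip_unicyclic_def cross_def)
      then show "e \<in> cross (f ` A) (f ` B)" by (auto simp: cross_def)
    qed
    moreover have "conn (f ` A \<union> f ` B) F"
      using conn_image[of "A \<union> B" E f] sub[OF E] E by (auto simp: F bip_unicyclic_def image_Un)
    moreover have "card F = card E" unfolding F using inj1 sub[OF E] by (meson card_image inj_on_subset)
    moreover have "card (f ` A) = card A" "card (f ` B) = card B"
      using assms(3) by (auto intro!: card_image intro: inj_on_subset)
    ultimately show "F \<in> bip_unicyclic (f ` A) (f ` B)" using E by (simp add: bip_unicyclic_def)
  qed
qed

lemma card_bip_unicyclic_image: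
  assumes "finite A" "finite B" "inj_on f (A \<union> B)"
  shows "card (bip_unicyclic (f ` A) (f ` B)) = card (bip_unicyclic A B)"
proof (rule antisym)
  define g where "g = inv_into (A \<union> B) f"
  have "g ` f ` A = A" "g ` f ` B = B"
    unfolding g_def using assms(3) by (simp_all add: inv_into_image_cancel)
  moreover have "inj_on g (f ` A \<union> f ` B)" unfolding g_def by (rule inj_on_inv_into) auto
  ultimately show "card (bip_unicyclic (f ` A) (f ` B)) \<le> card (bip_unicyclic A B)"
    using card_bip_unicyclic_le[of "f ` A" "f ` B" g] assms by simp
qed (rule card_bip_unicyclic_le[OF assms])

lemma N_bi_one:
  assumes "r + s > 0"
  shows "N_bi r s 1 = card (bip_unicyclic (Inl ` {..<r} :: (nat + nat) set) (Inr ` {..<s}))"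
proof (cases "r * s = 0")
  case True
  \<comment> \<open>With an empty side there are no edges at all, while a positive number
    \<open>r + s\<close> of them is required. This agrees with the convention in
    \<open>N_bi\<close>, which gives 0 for k = 1.\<close>
  have "E \<notin> bip_unicyclic (Inl ` {..<r} :: (nat + nat) set) (Inr ` {..<s})" for E
  proof
    assume E: "E \<in> bip_unicyclic (Inl ` {..<r} :: (nat + nat) set) (Inr ` {..<s})"
    moreover have "cross (Inl ` {..<r} :: (nat + nat) set) (Inr ` {..<s}) = {}" using True by (auto simp: cross_def)
    ultimately show False using assms by (auto simp: bip_unicyclic_def card_image)
  qed
  then have "bip_unicyclic (Inl ` {..<r} :: (nat + nat) set) (Inr ` {..<s}) = {}" by blast
  then show ?thesis using True by (auto simp: N_bi_def)
next
  case False
  have V: "bip_verts r s = Inl ` {..<r} \<union> Inr ` {..<s}" by (auto simp: bip_verts_def Plus_def)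
  have cr: "complete_bip_edges r s = cross (Inl ` {..<r}) (Inr ` {..<s})"
    unfolding complete_bip_edges_def cross_def by blast
  have "E \<subseteq> complete_bip_edges r s \<and> Digraph_Component.connected (with_proj (graph_of (bip_verts r s) E))
      \<and> int (card E) = int r + int s + 1 - 1 \<longleftrightarrow> E \<in> bip_unicyclic (Inl ` {..<r}) (Inr ` {..<s})" for E
  proof (cases "E \<subseteq> complete_bip_edges r s")
    case True
    have "Digraph_Component.connected (with_proj (graph_of (bip_verts r s) E)) \<longleftrightarrow> conn (bip_verts r s) E"
    proof (rule connected_graph_of_iff)
      show "bip_verts r s \<noteq> {}" using False by (auto simp: V)
      fix e assume "e \<in> E"
      then have "e \<in> cross (Inl ` {..<r}) (Inr ` {..<s})" using True cr by blast
      then show "\<exists>u\<in>bip_verts r s. \<exists>v\<in>bip_verts r s. e = {u, v}" unfolding V cross_def by blast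
    qed
    then show ?thesis using True by (auto simp: bip_unicyclic_def cr V card_image)
  qed (simp add: bip_unicyclic_def cr)
  then show ?thesis using False by (simp add: N_bi_def)
qed

lemma card_bip_unicyclic:
  assumes "finite A" "finite B" "A \<inter> B = {}" "A \<union> B \<noteq> {}"
  shows "card (bip_unicyclic A B) = N_bi (card A) (card B) 1"
proof -
  obtain f where f: "bij_betw f {..<card A} A" using ex_bij_betw_nat_finite[OF assms(1)] by (auto simp: atLeast0LessThan)
  obtain g where g: "bij_betw g {..<card B} B" using ex_bij_betw_nat_finite[OF assms(2)] by (auto simp: atLeast0LessThan)
  let ?h = "case_sum f g"
  have im: "?h ` Inl ` {..<card A} = A" "?h ` Inr ` {..<card B} = B"
    using f g by (auto simp: bij_betw_def image_image)
  have "inj_on ?h (Inl ` {..<card A} \<union> Inr ` {..<card B})"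
  proof (rule inj_onI)
    fix x y assume xy: "x \<in> Inl ` {..<card A} \<union> Inr ` {..<card B}" "y \<in> Inl ` {..<card A} \<union> Inr ` {..<card B}" "?h x = ?h y"
    have "f i \<in> A" "f i \<notin> B" if "i < card A" for i using f assms(3) that by (auto simp: bij_betw_def)
    moreover have "g i \<in> B" if "i < card B" for i using g that by (auto simp: bij_betw_def)
    ultimately have ne: "f i \<noteq> g j" if "i < card A" "j < card B" for i j using that by metis
    have inj: "inj_on f {..<card A}" "inj_on g {..<card B}" using f g by (auto simp: bij_betw_def)
    from xy consider (ll) i j where "x = Inl i" "y = Inl j" "i < card A" "j < card A"
      | (lr) i j where "x = Inl i" "y = Inr j" "i < card A" "j < card B"
      | (rl) i j where "x = Inr i" "y = Inl j" "i < card B" "j < card A"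
      | (rr) i j where "x = Inr i" "y = Inr j" "i < card B" "j < card B"
      by blast
    then show "x = y"
    proof cases
      case ll
      then show ?thesis using xy(3) inj(1) by (simp add: inj_on_eq_iff)
    next
      case lr
      then show ?thesis using xy(3) ne by simp
    next
      case rl
      then show ?thesis using xy(3) ne[of j i] by simp
    next
      case rr
      then show ?thesis using xy(3) inj(2) by (simp add: inj_on_eq_iff)
    qed
  qed
  from card_bip_unicyclic_image[OF _ _ this] have "card (bip_unicyclic A B)
      = card (bip_unicyclic (Inl ` {..<card A} :: (nat + nat) set) (Inr ` {..<card B}))" by (simp add: im)
  moreover have "card A + card B > 0" using assms by auto
  ultimately show ?thesis by (simp add: N_bi_one)
qed

text \<open>The coloured graphs are sorted by their first colour class; the binomial coefficient is
  the number of classes of size r.\<close>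

lemma N_bi_total_one:
  assumes "finite V" "V \<noteq> {}"
  shows "N_bi_total (card V) 1 = card (unicyclic V)"
proof -
  define n where "n = card V"
  have "unicyclic V = Sigma (Pow V) (\<lambda>A. bip_unicyclic A (V - A))"
  proof -
    have "card V = card A + card (V - A)" "A \<union> (V - A) = V" if "A \<subseteq> V" for A
      using that assms(1) by (auto simp: card_Diff_subset finite_subset card_mono)
    then show ?thesis by (auto simp: unicyclic_def bip_unicyclic_def)
  qed
  then have "card (unicyclic V) = (\<Sum>A\<in>Pow V. card (bip_unicyclic A (V - A)))"
    using assms(1) by (simp add: card_SigmaI finite_bip_unicyclic finite_subset)
  also have "\<dots> = (\<Sum>A\<in>Pow V. N_bi (card A) (n - card A) 1)"
  proof (rule sum.cong)
    fix A assume "A \<in> Pow V"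
    then have A: "A \<subseteq> V" "finite A" using assms(1) by (auto dest: finite_subset)
    then have "card (V - A) = n - card A" "A \<union> (V - A) = V" by (auto simp: card_Diff_subset n_def)
    then show "card (bip_unicyclic A (V - A)) = N_bi (card A) (n - card A) 1"
      using card_bip_unicyclic[of A "V - A"] A assms by simp
  qed simp
  also have "\<dots> = (\<Sum>r\<le>n. (n choose r) * N_bi r (n - r) 1)"
    using sum_Pow_card[OF assms(1), of "\<lambda>r. N_bi r (n - r) 1"] by (simp add: n_def)
  also have "\<dots> = (\<Sum>(r, s) | r + s = n. (n choose r) * N_bi r s 1)"
    by (rule sum.reindex_bij_witness[of _ fst "\<lambda>r. (r, n - r)"]) auto
  finally show ?thesis by (simp add: N_bi_total_def n_def)
qed

section \<open>Gaussian limit of the even sum\<close>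

lemma fact_quotient_eq_prod:
  assumes "j \<le> n" "n > 0"
  shows "fact n / (fact (n - j) * real n ^ j) = (\<Prod>i<j. 1 - real i / real n)"
  using assms(1)
proof (induction j)
  case (Suc j)
  have "n - j = Suc (n - Suc j)" using Suc.prems by simp
  then have "fact (n - j) = real (n - j) * fact (n - Suc j)"
    by (metis fact_Suc of_nat_Suc)
  moreover have "real (n - j) = real n * (1 - real j / real n)" "real j < real n"
    using Suc.prems assms(2) by (auto simp: field_simps of_nat_diff)
  ultimately have "fact n / (fact (n - Suc j) * real n ^ Suc j)
      = fact n / (fact (n - j) * real n ^ j) * (1 - real j / real n)"
    by (simp add: divide_simps)
  then show ?case using Suc by simp
qed simp

text \<open>The factor with i = n vanishes. Thus the product form of the summands cuts the series
  off by itself.\<close>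

lemma prod_one_minus_zero:
  assumes "n < j" "n > 0"
  shows "(\<Prod>i<j. 1 - real i / real n) = 0"
  using assms by (auto intro!: bexI[of _ n])

lemma prod_one_minus_nonneg:
  assumes "n > 0"
  shows "(\<Prod>i<j. 1 - real i / real n) \<ge> 0"
proof (cases "n < j")
  case False
  then show ?thesis using assms by (intro prod_nonneg) (auto simp: field_simps)
qed (simp only: prod_one_minus_zero assms)

lemma sum_lessThan_real: "(\<Sum>i<j. real i) = real j * (real j - 1) / 2"
  by (induction j) (auto simp: field_simps)

lemma prod_one_minus_le:
  assumes "n > 0"
  shows "(\<Prod>i<j. 1 - real i / real n) \<le> exp (- (real j * (real j - 1) / (2 * real n)))"
proof (cases "n < j")
  case False
  have "(\<Prod>i<j. 1 - real i / real n) \<le> (\<Prod>i<j. exp (- (real i / real n)))"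
  proof (rule prod_mono)
    fix i assume "i \<in> {..<j}"
    then show "0 \<le> 1 - real i / real n \<and> 1 - real i / real n \<le> exp (- (real i / real n))"
      using False assms exp_ge_add_one_self[of "- (real i / real n)"] by (simp add: field_simps)
  qed
  also have "\<dots> = exp (- ((\<Sum>i<j. real i) / real n))"
    by (simp flip: exp_sum add: sum_negf sum_divide_distrib)
  finally show ?thesis by (simp add: sum_lessThan_real)
qed (simp add: prod_one_minus_zero assms)

text \<open>For t between 0 and 1/2 one has 1 - t \<ge> exp (- t - 2 t^2). The linear terms give the
  same exponent as in the upper bound, and bounding each i by j in the quadratic terms gives the
  error j^3/n^2.\<close>

lemma prod_one_minus_ge:
  assumes "n > 0" "2 * j \<le> n"
  shows "(\<Prod>i<j. 1 - real i / real n)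
    \<ge> exp (- (real j * (real j - 1) / (2 * real n)) - 2 * (real j ^ 3 / real n ^ 2))"
proof -
  have "exp (- (real j * (real j - 1) / (2 * real n)) - 2 * (real j ^ 3 / real n ^ 2))
      \<le> exp (\<Sum>i<j. - (real i / real n) - 2 * (real i / real n)\<^sup>2)"
  proof -
    have "(\<Sum>i<j. (real i / real n)\<^sup>2) \<le> (\<Sum>i<j. (real j / real n)\<^sup>2)"
      by (intro sum_mono power_mono divide_right_mono) auto
    also have "\<dots> = real j ^ 3 / real n ^ 2"
      by (simp add: power_divide power2_eq_square power3_eq_cube)
    finally have "(\<Sum>i<j. (real i / real n)\<^sup>2) \<le> real j ^ 3 / real n ^ 2" .
    moreover have "(\<Sum>i<j. real i / real n) = real j * (real j - 1) / (2 * real n)"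
      by (simp flip: sum_divide_distrib add: sum_lessThan_real)
    ultimately show ?thesis
      by (simp add: sum_subtractf sum_negf flip: sum_distrib_left)
  qed
  also have "\<dots> = (\<Prod>i<j. exp (- (real i / real n) - 2 * (real i / real n)\<^sup>2))"
    by (simp add: exp_sum)
  also have "\<dots> \<le> (\<Prod>i<j. 1 - real i / real n)"
  proof (rule prod_mono)
    fix i assume "i \<in> {..<j}"
    then have i: "0 \<le> real i / real n" "real i / real n \<le> 1/2" using assms by (auto simp: field_simps)
    then have "- (real i / real n) - 2 * (real i / real n)\<^sup>2 \<le> ln (1 - real i / real n)"
      by (rule ln_one_minus_pos_lower_bound)
    then show "0 \<le> exp (- (real i / real n) - 2 * (real i / real n)\<^sup>2) \<and>
        exp (- (real i / real n) - 2 * (real i / real n)\<^sup>2) \<le> 1 - real i / real n"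
      using i by (subst (asm) ln_ge_iff) (simp_all add: le_less_trans[OF i(2)])
  qed
  finally show ?thesis .
qed

text \<open>The product lies between the two exponential bounds. When j grows like y sqrt n, the
  common exponent tends to - y^2/2 and the error term, of order 1/sqrt n, tends to 0.\<close>

lemma prod_one_minus_tendsto:
  fixes j :: "nat \<Rightarrow> nat"
  assumes "(\<lambda>n. real (j n) / sqrt (real n)) \<longlonglongrightarrow> y"
  shows "(\<lambda>n. \<Prod>i<j n. 1 - real i / real n) \<longlonglongrightarrow> exp (- (y\<^sup>2 / 2))"
proof (rule tendsto_sandwich)
  have inv: "(\<lambda>n. 1 / sqrt (real n)) \<longlonglongrightarrow> 0" by real_asymp
  have quad: "(\<lambda>n. real (j n) * (real (j n) - 1) / (2 * real n)) \<longlonglongrightarrow> y\<^sup>2 / 2"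
  proof (rule Lim_transform_eventually)
    show "(\<lambda>n. real (j n) / sqrt (real n) * (real (j n) / sqrt (real n) - 1 / sqrt (real n)) / 2)
        \<longlonglongrightarrow> y\<^sup>2 / 2"
      using tendsto_divide[OF tendsto_mult[OF assms tendsto_diff[OF assms inv]] tendsto_const[of 2]]
      by (simp add: power2_eq_square)
    show "\<forall>\<^sub>F n in sequentially.
        real (j n) / sqrt (real n) * (real (j n) / sqrt (real n) - 1 / sqrt (real n)) / 2
        = real (j n) * (real (j n) - 1) / (2 * real n)"
      using eventually_gt_at_top[of 0] by eventually_elim (simp add: field_simps)
  qed
  have cub: "(\<lambda>n. real (j n) ^ 3 / real n ^ 2) \<longlonglongrightarrow> 0"
  proof (rule Lim_transform_eventually)
    show "(\<lambda>n. (real (j n) / sqrt (real n)) ^ 3 * (1 / sqrt (real n))) \<longlonglongrightarrow> 0"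
      using tendsto_mult[OF tendsto_power[OF assms, of 3] inv] by simp
    show "\<forall>\<^sub>F n in sequentially.
        (real (j n) / sqrt (real n)) ^ 3 * (1 / sqrt (real n)) = real (j n) ^ 3 / real n ^ 2"
      by (simp add: power_divide power2_eq_square power3_eq_cube field_simps)
  qed
  show "(\<lambda>n. exp (- (real (j n) * (real (j n) - 1) / (2 * real n)) - 2 * (real (j n) ^ 3 / real n ^ 2)))
      \<longlonglongrightarrow> exp (- (y\<^sup>2 / 2))"
    using tendsto_exp[OF tendsto_diff[OF tendsto_minus[OF quad] tendsto_mult[OF tendsto_const[of 2] cub]]]
    by simp
  show "(\<lambda>n. exp (- (real (j n) * (real (j n) - 1) / (2 * real n)))) \<longlonglongrightarrow> exp (- (y\<^sup>2 / 2))"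
    by (intro tendsto_intros quad)
  show "\<forall>\<^sub>F n in sequentially. (\<Prod>i<j n. 1 - real i / real n)
      \<le> exp (- (real (j n) * (real (j n) - 1) / (2 * real n)))"
    using eventually_gt_at_top[of 0] by eventually_elim (rule prod_one_minus_le)
  \<comment> \<open>Here j/n tends to 0, so eventually \<open>2 * j n\<close> is at most
    \<open>n\<close>, as the lower bound demands.\<close>
  have "(\<lambda>n. real (j n) / sqrt (real n) * (1 / sqrt (real n))) \<longlonglongrightarrow> 0"
    using tendsto_mult[OF assms inv] by simp
  then have "\<forall>\<^sub>F n in sequentially. real (j n) / sqrt (real n) * (1 / sqrt (real n)) < 1/2"
    by (rule order_tendstoD) simp
  then have "\<forall>\<^sub>F n in sequentially. 2 * j n \<le> n"
    using eventually_gt_at_top[of 0] by eventually_elim (simp add: field_simps)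
  then show "\<forall>\<^sub>F n in sequentially.
      exp (- (real (j n) * (real (j n) - 1) / (2 * real n)) - 2 * (real (j n) ^ 3 / real n ^ 2))
      \<le> (\<Prod>i<j n. 1 - real i / real n)"
    using eventually_gt_at_top[of 0] by eventually_elim (rule prod_one_minus_ge)
qed

text \<open>The summand with k = floor (x sqrt (n/2)) as a function of x: each summand occupies an
  interval of length 1/sqrt (n/2), so the integral is the sum divided by sqrt (n/2). The indicator
  is essential because \<open>nat\<close> sends negative floors to 0, where the product is
  1.\<close>

definition step_fun :: "nat \<Rightarrow> real \<Rightarrow> real" where
  "step_fun n x = indicator {0..} x * (\<Prod>i<2 * nat \<lfloor>x * sqrt (real n / 2)\<rfloor>. 1 - real i / real n)"

lemma step_fun_eq_sum:
  assumes "n > 0"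
  shows "step_fun n x = (\<Sum>k\<le>n div 2. (\<Prod>i<2*k. 1 - real i / real n) *
     indicator {real k / sqrt (real n / 2)..<real (Suc k) / sqrt (real n / 2)} x)"
    (is "_ = (\<Sum>k\<le>_. ?t k * indicator (?I k) x)")
proof -
  define c where "c = sqrt (real n / 2)"
  have c: "c > 0" using assms by (simp add: c_def)
  define k0 where "k0 = nat \<lfloor>x * c\<rfloor>"
  have mem: "x \<in> ?I k \<longleftrightarrow> x \<ge> 0 \<and> k = k0" for k
  proof -
    have "x \<in> ?I k \<longleftrightarrow> real k \<le> x * c \<and> x * c < real k + 1"
      using c by (auto simp: field_simps simp flip: c_def)
    also have "\<dots> \<longleftrightarrow> \<lfloor>x * c\<rfloor> = int k" by (auto simp: floor_eq_iff)
    also have "\<dots> \<longleftrightarrow> x * c \<ge> 0 \<and> k = k0" unfolding k0_def by linarith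
    finally show ?thesis using c by (simp add: zero_le_mult_iff)
  qed
  show ?thesis
  proof (cases "x \<ge> 0")
    case True
    have "(\<Sum>k\<le>n div 2. ?t k * indicator (?I k) x) = (\<Sum>k\<le>n div 2. if k = k0 then ?t k0 else 0)"
      by (rule sum.cong) (use True mem in \<open>auto simp: indicator_def\<close>)
    also have "\<dots> = ?t k0"
    proof (cases "k0 \<le> n div 2")
      case False
      \<comment> \<open>Beyond \<open>n div 2\<close> the product contains the zero factor, so the
        finite sum misses nothing.\<close>
      then have "?t k0 = 0" by (intro prod_one_minus_zero assms) auto
      then show ?thesis by simp
    qed auto
    finally show ?thesis using True by (simp add: step_fun_def k0_def c_def)
  next
    case False
    then have "indicator (?I k) x = (0::real)" for k using mem[of k] by (simp add: indicator_def)
    then show ?thesis using False by (simp add: step_fun_def)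
  qed
qed

lemma integral_step_fun:
  assumes "n > 0"
  shows "integral\<^sup>L lborel (step_fun n) =
    (\<Sum>k\<le>n div 2. \<Prod>i<2*k. 1 - real i / real n) / sqrt (real n / 2)"
proof -
  define c where "c = sqrt (real n / 2)"
  have c: "c > 0" using assms by (simp add: c_def)
  have em: "emeasure lborel {real k / c..<real (Suc k) / c} = ennreal (1 / c)" for k
    using c by (subst emeasure_lborel_Ico) (auto simp: divide_right_mono field_simps)
  have "integral\<^sup>L lborel (step_fun n) = (\<Sum>k\<le>n div 2. (\<Prod>i<2*k. 1 - real i / real n) *
      measure lborel {real k / c..<real (Suc k) / c})"
    unfolding step_fun_eq_sum[OF assms, abs_def] c_def[symmetric]
    by (subst Bochner_Integration.integral_sum)
       (auto intro!: integrable_mult_right integrable_real_indicator simp: em simp del: of_nat_Suc)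
  also have "\<dots> = (\<Sum>k\<le>n div 2. (\<Prod>i<2*k. 1 - real i / real n) * (1 / c))"
    using c by (intro sum.cong refl) (simp add: measure_def em del: of_nat_Suc)
  finally show ?thesis by (simp add: c_def sum_divide_distrib)
qed

text \<open>Completing the square, 6x - x^2 = 9 - (x - 3)^2, a multiple of the normal density with
  mean 3 and variance 1/2.\<close>

lemma integrable_gauss_shift: "integrable lborel (\<lambda>x::real. exp (6 * x - x\<^sup>2))"
proof -
  have "integrable lborel (\<lambda>x. exp 9 * sqrt pi * normal_density 3 (sqrt (1/2)) x)"
    by (intro integrable_mult_right integrable_normal_density) auto
  moreover have "exp 9 * sqrt pi * normal_density 3 (sqrt (1/2)) x = exp (6 * x - x\<^sup>2)" for x
    by (simp add: normal_density_def power2_eq_square algebra_simps flip: exp_add)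
  ultimately show ?thesis by simp
qed

text \<open>A bound independent of n for dominated convergence. Rounding x sqrt (n/2) down and the
  product 2k (2k - 1) in place of (2k)^2 cost only a term linear in x; the coefficient 6 absorbs it
  for all n \<ge> 1.\<close>

lemma step_fun_le:
  assumes "n > 0"
  shows "norm (step_fun n x) \<le> exp (6 * x - x\<^sup>2)"
proof (cases "x \<ge> 0")
  case True
  define c where "c = sqrt (real n / 2)"
  have c: "c > 0" "2 * c\<^sup>2 = real n" using assms by (auto simp: c_def)
  define k where "k = nat \<lfloor>x * c\<rfloor>"
  have k: "real k \<le> x * c" "x * c < real k + 1" using True c by (auto simp: k_def)
  have "real n \<ge> 1" using assms by simp
  then have c_half: "c \<ge> 1/2" using c by (auto intro: power2_le_imp_le simp: power2_eq_square)
  have "norm (step_fun n x) \<le> exp (- (real (2*k) * (real (2*k) - 1) / (2 * real n)))"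
    using True prod_one_minus_le[OF assms, of "2*k"] prod_one_minus_nonneg[OF assms]
    by (simp add: step_fun_def k_def c_def)
  also have "\<dots> \<le> exp (6 * x - x\<^sup>2)"
  proof -
    have "(x\<^sup>2 - 6 * x) * (2 * real n) \<le> real (2*k) * (real (2*k) - 1)"
    \<comment> \<open>From 3/2 on, the factor \<open>2 * (x * c - 1) - 1\<close> is nonnegative and
      the two lower bounds may be multiplied. Below it, \<open>c\<close> \<ge> 1/2 gives x < 3, so
      x^2 - 6x is not positive and the claim is clear.\<close>
    proof (cases "x * c \<ge> 3/2")
      case True
      have "real (2*k) * (real (2*k) - 1) \<ge> (2 * (x * c - 1)) * (2 * (x * c - 1) - 1)"
        using k True by (intro mult_mono) auto
      moreover have "(2 * (x * c - 1)) * (2 * (x * c - 1) - 1) = 4 * (x * c)\<^sup>2 - 10 * (x * c) + 6"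
        by (simp add: power2_eq_square algebra_simps)
      moreover have "(x\<^sup>2 - 6 * x) * (2 * real n) = 4 * (x * c)\<^sup>2 - 24 * (x * c) * c"
        unfolding c(2)[symmetric] by (simp add: power2_eq_square algebra_simps)
      moreover have "24 * (x * c) * c \<ge> 24 * (x * c) * (1/2)" using c_half \<open>x \<ge> 0\<close> c
        by (intro mult_left_mono) auto
      ultimately show ?thesis using True by linarith
    next
      case False
      have "x * (1/2) \<le> x * c" using c_half \<open>x \<ge> 0\<close> by (intro mult_left_mono)
      then have "x * (x - 6) \<le> 0" using False \<open>x \<ge> 0\<close> by (intro mult_nonneg_nonpos) auto
      then have "(x\<^sup>2 - 6 * x) * (2 * real n) \<le> 0"
        by (intro mult_nonpos_nonneg) (auto simp: power2_eq_square algebra_simps)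
      moreover have "real (2*k) * (real (2*k) - 1) \<ge> 0" by (cases k) auto
      ultimately show ?thesis by linarith
    qed
    then have "x\<^sup>2 - 6 * x \<le> real (2*k) * (real (2*k) - 1) / (2 * real n)"
      using assms by (subst pos_le_divide_eq) auto
    then show ?thesis by simp
  qed
  finally show ?thesis .
qed (simp add: step_fun_def)

lemma step_fun_tendsto: "(\<lambda>n. step_fun n x) \<longlonglongrightarrow> indicator {0..} x * exp (- x\<^sup>2)"
proof (cases "x \<ge> 0")
  case True
  \<comment> \<open>With y = sqrt 2 x, the limit exp (- y^2/2) of the product becomes exp (-
    x^2).\<close>
  have "(\<lambda>n. real (2 * nat \<lfloor>x * sqrt (real n / 2)\<rfloor>) / sqrt (real n)) \<longlonglongrightarrow> sqrt 2 * x"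
  proof (rule tendsto_sandwich)
    have bd: "real (nat \<lfloor>x * sqrt (real n / 2)\<rfloor>) \<le> x * sqrt (real n / 2)"
      "real (nat \<lfloor>x * sqrt (real n / 2)\<rfloor>) \<ge> x * sqrt (real n / 2) - 1" for n
      using True by (simp, linarith)
    show "\<forall>\<^sub>F n in sequentially. (2 * (x * sqrt (real n / 2) - 1)) / sqrt (real n)
        \<le> real (2 * nat \<lfloor>x * sqrt (real n / 2)\<rfloor>) / sqrt (real n)"
      using bd(2) by (intro always_eventually allI divide_right_mono) (simp_all only: of_nat_mult of_nat_numeral mult_le_cancel_left_pos zero_less_numeral real_sqrt_ge_zero of_nat_0_le_iff)
    show "\<forall>\<^sub>F n in sequentially. real (2 * nat \<lfloor>x * sqrt (real n / 2)\<rfloor>) / sqrt (real n)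
        \<le> (2 * (x * sqrt (real n / 2))) / sqrt (real n)"
      using bd(1) by (intro always_eventually allI divide_right_mono) auto
    have eq: "sqrt (real n / 2) / sqrt (real n) = 1 / sqrt 2" if "n > 0" for n
      using that by (simp add: real_sqrt_divide)
    have s2: "2 / sqrt 2 = sqrt 2" by (simp add: real_div_sqrt)
    have up: "\<forall>\<^sub>F n in sequentially. sqrt 2 * x = (2 * (x * sqrt (real n / 2))) / sqrt (real n)"
      using eventually_gt_at_top[of 0]
    proof eventually_elim
      case (elim n)
      have "(2 * (x * sqrt (real n / 2))) / sqrt (real n) = 2 * x * (sqrt (real n / 2) / sqrt (real n))"
        by simp
      also have "\<dots> = (2 / sqrt 2) * x" using eq[OF elim] by simp
      finally show ?case by (simp add: s2)
    qed
    show U: "(\<lambda>n. (2 * (x * sqrt (real n / 2))) / sqrt (real n)) \<longlonglongrightarrow> sqrt 2 * x"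
      by (rule Lim_transform_eventually[OF tendsto_const up])
    have "(\<lambda>n. 2 / sqrt (real n)) \<longlonglongrightarrow> 0" by real_asymp
    from tendsto_diff[OF U this]
    show "(\<lambda>n. (2 * (x * sqrt (real n / 2) - 1)) / sqrt (real n)) \<longlonglongrightarrow> sqrt 2 * x"
      by (simp add: right_diff_distrib diff_divide_distrib)
  qed
  from prod_one_minus_tendsto[OF this] show ?thesis
    using True by (simp add: step_fun_def power_mult_distrib)
qed (simp add: step_fun_def)

lemma even_sum_asymptotics:
  "(\<lambda>n. (\<Sum>k\<le>n div 2. \<Prod>i<2*k. 1 - real i / real n) / sqrt (real n)) \<longlonglongrightarrow> sqrt (pi / 8)"
proof -
  have meas: "step_fun n \<in> borel_measurable lborel" for n
    unfolding step_fun_def[abs_def] by measurable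
  \<comment> \<open>The index is shifted because \<open>step_fun 0\<close> is the indicator of the
    half-line, to which the dominating function does not apply.\<close>
  have "(\<lambda>n. integral\<^sup>L lborel (step_fun (Suc n)))
      \<longlonglongrightarrow> integral\<^sup>L lborel (\<lambda>x. indicator {0..} x * exp (- x\<^sup>2))"
  proof (rule integral_dominated_convergence)
    show "AE x in lborel. (\<lambda>n. step_fun (Suc n) x) \<longlonglongrightarrow> indicator {0..} x * exp (- x\<^sup>2)"
      by (intro AE_I2 LIMSEQ_Suc step_fun_tendsto)
    show "AE x in lborel. norm (step_fun (Suc n) x) \<le> exp (6 * x - x\<^sup>2)" for n
      by (intro AE_I2 step_fun_le) simp
  qed (use integrable_gauss_shift meas in auto)
  moreover have "integral\<^sup>L lborel (\<lambda>x::real. indicator {0..} x * exp (- x\<^sup>2)) = sqrt pi / 2"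
    using has_bochner_integral_integral_eq[OF gaussian_moment_0] by simp
  ultimately have "(\<lambda>n. integral\<^sup>L lborel (step_fun n)) \<longlonglongrightarrow> sqrt pi / 2"
    by (intro LIMSEQ_imp_Suc[of "\<lambda>n. integral\<^sup>L lborel (step_fun n)"]) simp
  then have "(\<lambda>n. integral\<^sup>L lborel (step_fun n) * sqrt (1 / 2)) \<longlonglongrightarrow> sqrt pi / 2 * sqrt (1 / 2)"
    by (intro tendsto_intros)
  moreover have "sqrt pi / 2 * sqrt (1 / 2) = sqrt (pi / 8)"
  proof -
    have "sqrt (pi / 8) = sqrt (pi * (1/2) * (1/4))" by simp
    also have "\<dots> = sqrt pi * sqrt (1/2) * sqrt (1/4)" by (simp only: real_sqrt_mult)
    also have "sqrt (1/4) = (1/2 :: real)" by (simp add: real_sqrt_divide)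
    finally show ?thesis by simp
  qed
  ultimately have "(\<lambda>n. integral\<^sup>L lborel (step_fun n) * sqrt (1 / 2)) \<longlonglongrightarrow> sqrt (pi / 8)" by simp
  then show ?thesis
  proof (rule Lim_transform_eventually)
    show "\<forall>\<^sub>F n in sequentially. integral\<^sup>L lborel (step_fun n) * sqrt (1 / 2)
        = (\<Sum>k\<le>n div 2. \<Prod>i<2*k. 1 - real i / real n) / sqrt (real n)"
      using eventually_gt_at_top[of 0]
      by eventually_elim (simp add: integral_step_fun real_sqrt_divide)
  qed
qed

section \<open>The exact formula and its asymptotics\<close>

theorem theorem1p3:
  shows "(\<forall>n::nat. n \<ge> 4 \<longrightarrow>
           real (N_bi_total n 1) =
             real n ^ (n - 1) *
               (\<Sum>k | 2 \<le> k \<and> real k \<le> real n / 2. fact n / (fact (n - 2 * k) * real n ^ (2 * k))))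
       \<and> (\<lambda>n. real (N_bi_total n 1)) \<sim>[sequentially]
           (\<lambda>n. sqrt (pi / 8) * real n powr (real n - 1 / 2))"
proof -
  define S :: "nat \<Rightarrow> real" where
    "S n = (\<Sum>k | 2 \<le> k \<and> real k \<le> real n / 2. fact n / (fact (n - 2 * k) * real n ^ (2 * k)))" for n
  have range: "{k. 2 \<le> k \<and> real k \<le> real n / 2} = {k. 2 \<le> k \<and> 2 * k \<le> n}" for n by auto
  have total: "real (N_bi_total n 1) = real n ^ (n - 1) * S n" if "n > 0" for n
  proof -
    have "real (N_bi_total n 1) = cycle_sum n"
      using N_bi_total_one[of "{..<n}"] card_unicyclic[of "{..<n}"] that by (simp add: lessThan_empty_iff)
    also have "\<dots> = real n ^ (n - 1) * S n"
      unfolding cycle_sum_def S_def range sum_distrib_left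
    proof (rule sum.cong)
      fix k assume "k \<in> {k. 2 \<le> k \<and> 2 * k \<le> n}"
      then have "real n * real n ^ (n - 1) = real n ^ (n - 2 * k) * real n ^ (2 * k)"
        using that by (simp flip: power_Suc power_add)
      then have "real n ^ (n - 2 * k) / real n = real n ^ (n - 1) / real n ^ (2 * k)"
        using that by (simp add: field_simps)
      then show "fact n / fact (n - 2 * k) * (real n ^ (n - 2 * k) / real n)
          = real n ^ (n - 1) * (fact n / (fact (n - 2 * k) * real n ^ (2 * k)))" by simp
    qed simp
    finally show ?thesis .
  qed
  \<comment> \<open>The sum starts at k = 2. The terms k = 0 and k = 1 removed from the full sum are
    1 and 1 - 1/n, which is negligible against sqrt n.\<close>
  have S_eq: "S n = (\<Sum>k\<le>n div 2. \<Prod>i<2*k. 1 - real i / real n) - 1 - (1 - 1 / real n)" if "n \<ge> 4" for n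
  proof -
    have "{..n div 2} = {0, 1} \<union> {k. 2 \<le> k \<and> 2 * k \<le> n}" using that by auto
    moreover have "finite {k. 2 \<le> k \<and> 2 * k \<le> n}" by (rule finite_subset[of _ "{..n}"]) auto
    ultimately have "(\<Sum>k\<le>n div 2. \<Prod>i<2*k. 1 - real i / real n) =
        (\<Sum>k\<in>{0, 1}. \<Prod>i<2*k. 1 - real i / real n) + (\<Sum>k | 2 \<le> k \<and> 2 * k \<le> n. \<Prod>i<2*k. 1 - real i / real n)"
      by (simp only:) (rule sum.union_disjoint; auto)
    moreover have "S n = (\<Sum>k | 2 \<le> k \<and> 2 * k \<le> n. \<Prod>i<2*k. 1 - real i / real n)"
      unfolding S_def range using that by (intro sum.cong refl fact_quotient_eq_prod) auto
    ultimately show ?thesis by (simp add: numeral_2_eq_2)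
  qed
  have "(\<lambda>n. (2 - 1 / real n) / sqrt (real n)) \<longlonglongrightarrow> 0" by real_asymp
  from tendsto_diff[OF even_sum_asymptotics this]
  have "(\<lambda>n. (\<Sum>k\<le>n div 2. \<Prod>i<2*k. 1 - real i / real n) / sqrt (real n) - (2 - 1 / real n) / sqrt (real n))
      \<longlonglongrightarrow> sqrt (pi / 8)" by simp
  then have "(\<lambda>n. S n / sqrt (real n)) \<longlonglongrightarrow> sqrt (pi / 8)"
    by (rule Lim_transform_eventually)
       (use eventually_ge_at_top[of 4] in eventually_elim, simp add: S_eq flip: diff_divide_distrib)
  from tendsto_divide[OF this tendsto_const[of "sqrt (pi / 8)"]]
  have lim: "(\<lambda>n. S n / sqrt (real n) / sqrt (pi / 8)) \<longlonglongrightarrow> 1" by simp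
  have "(\<lambda>n. real (N_bi_total n 1)) \<sim>[sequentially] (\<lambda>n. sqrt (pi / 8) * real n powr (real n - 1 / 2))"
  proof (rule asymp_equivI', rule Lim_transform_eventually[OF lim])
    show "\<forall>\<^sub>F n in sequentially. S n / sqrt (real n) / sqrt (pi / 8)
        = real (N_bi_total n 1) / (sqrt (pi / 8) * real n powr (real n - 1 / 2))"
      using eventually_gt_at_top[of 0]
    proof eventually_elim
      case (elim n)
      \<comment> \<open>Splitting the exponent as (n - 1) + 1/2 separates the prefactor of the exact
        formula from the sqrt n by which the sum grows.\<close>
      have "real n powr (real n - 1 / 2) = real n powr (real (n - 1) + 1 / 2)"
        using elim by (simp add: of_nat_diff)
      also have "\<dots> = real n ^ (n - 1) * sqrt (real n)"
        using elim by (simp only: powr_add powr_realpow powr_half_sqrt of_nat_0_le_iff of_nat_0_less_iff)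
      finally show ?case using total[OF elim] elim by simp
    qed
  qed
  then show ?thesis using total unfolding S_def by auto
qed

end
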